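(* Let $\mathcal{G}=(V,\mathcal{B},E)$ be a bounded degree Borel graph that contains no odd cycles. Then $\chi'_{App}(\mathcal{G})=\Delta(\mathcal{G})$.
   Context: A Borel graph is a triple $\mathcal{G}=(V,\mathcal{B},E)$ where $(V,\mathcal{B})$ is a standard Borel space and $E\subseteq V\times V$ is a Borel, symmetric, irreflexive set (the edges). $\Delta(\mathcal{G})$ denotes the maximum degree of a vertex; $\mathcal{G}$ has bounded degree if $\Delta(\mathcal{G})\in\mathbb{N}$. For $k\in\mathbb{N}$ (identified with $\{0,\dots,k-1\}$), a partial edge coloring $c;E\to k$ is a Borel map whose domain $\operatorname{dom}(c)\subseteq E$ is a Borel set, with $c(x,y)=c(y,x)$ whenever $(x,y)\in\operatorname{dom}(c)$; it is an edge coloring, written $c:E\to k$, if $\operatorname{dom}(c)=E$. $\mathbf{Corr}(c)$ is the set of vertices $x\in V$ such that $(x,y)\in\operatorname{dom}(c)$ for every $(x,y)\in E$ and $c(x,y)\neq c(x,z)$ for all distinct $(x,y),(x,z)\in\operatorname{dom}(c)$. The approximate chromatic index $\chi'_{App}(\mathcal{G})$ is the minimal $k\in\mathbb{N}$ such that for every Borel probability measure $\mu$ on $(V,\mathcal{B})$ and every $\epsilon>0$ there is an edge coloring $c:E\to k$ with $\mu(\mathbf{Corr}(c))>1-\epsilon$. *)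

theory Defs
  imports "HOL-Probability.Probability"
begin

text \<open>A Borel graph on the standard Borel space (V, B), where V is the carrier of a
Polish space type 'a and B = sets borel. The edge set E is a subset of V x V.\<close>

definition borel_graph :: "('a::polish_space \<times> 'a) set \<Rightarrow> bool" where
  "borel_graph E \<longleftrightarrow> E \<in> sets (borel \<Otimes>\<^sub>M borel)
     \<and> (\<forall>x y. (x, y) \<in> E \<longrightarrow> (y, x) \<in> E)
     \<and> (\<forall>x. (x, x) \<notin> E)"

definition neighbours :: "('a \<times> 'a) set \<Rightarrow> 'a \<Rightarrow> 'a set" where
  "neighbours E x = {y. (x, y) \<in> E}"

definition degree :: "('a \<times> 'a) set \<Rightarrow> 'a \<Rightarrow> enat" where
  "degree E x = (if finite (neighbours E x) then enat (card (neighbours E x)) else \<infinity>)"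

definition max_degree :: "('a \<times> 'a) set \<Rightarrow> enat" where
  "max_degree E = (SUP x. degree E x)"

definition bounded_degree :: "('a \<times> 'a) set \<Rightarrow> bool" where
  "bounded_degree E \<longleftrightarrow> max_degree E \<noteq> \<infinity>"

definition edge_coloring :: "('a::polish_space \<times> 'a) set \<Rightarrow> nat \<Rightarrow> ('a \<times> 'a \<Rightarrow> nat) \<Rightarrow> bool" where
  "edge_coloring E k c \<longleftrightarrow>
     c \<in> measurable (restrict_space (borel \<Otimes>\<^sub>M borel) E) (count_space {..<k})
     \<and> (\<forall>x y. (x, y) \<in> E \<longrightarrow> c (x, y) = c (y, x))"

text \<open>Corr(c) for a total edge coloring (the domain condition is then automatic).\<close>
definition Corr :: "('a \<times> 'a) set \<Rightarrow> ('a \<times> 'a \<Rightarrow> nat) \<Rightarrow> 'a set" where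
  "Corr E c = {x. \<forall>y z. (x, y) \<in> E \<longrightarrow> (x, z) \<in> E \<longrightarrow> y \<noteq> z \<longrightarrow> c (x, y) \<noteq> c (x, z)}"

definition approx_colorable :: "('a::polish_space \<times> 'a) set \<Rightarrow> nat \<Rightarrow> bool" where
  "approx_colorable E k \<longleftrightarrow>
     (\<forall>\<mu>::'a measure. \<forall>\<epsilon>::real.
        sets \<mu> = sets borel \<and> prob_space \<mu> \<and> \<epsilon> > 0 \<longrightarrow>
        (\<exists>c. edge_coloring E k c \<and> Corr E c \<in> sets \<mu> \<and> measure \<mu> (Corr E c) > 1 - \<epsilon>))"

definition chi_app :: "('a::polish_space \<times> 'a) set \<Rightarrow> nat" where
  "chi_app E = (LEAST k. approx_colorable E k)"

definition has_odd_cycle :: "('a \<times> 'a) set \<Rightarrow> bool" where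
  "has_odd_cycle E \<longleftrightarrow> (\<exists>n::nat. \<exists>v::nat \<Rightarrow> 'a. odd n \<and> n \<ge> 3 \<and> inj_on v {..<n}
      \<and> (\<forall>i<n. (v i, v (Suc i mod n)) \<in> E))"

end

theory Submission
  imports Defs
begin

text \<open>
  The lower bound comes from the Dirac measure at a vertex. For the upper bound with
  \<open>k = \<Delta>\<close> colors, a partial proper coloring is improved as long as the set of vertices with
  an uncolored edge has measure at least \<open>\<epsilon>\<close>. If \<open>x y\<close> is uncolored, \<open>a\<close> is missing at
  \<open>x\<close> and \<open>b\<close> is missing at \<open>y\<close>, then the \<open>a\<close>-\<open>b\<close>-path starting at \<open>y\<close> avoids \<open>x\<close>, since
  otherwise it would close up to an odd cycle; so swapping \<open>a\<close> and \<open>b\<close> on it frees \<open>a\<close> for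
  \<open>x y\<close>. If the path is long or infinite, it is first cut by uncoloring its edge number
  \<open>2 s + 1\<close>. The vertices at a fixed position \<open>t\<close> of these paths, for varying starting
  points and varying \<open>t\<close> of fixed parity, are pairwise distinct. Hence, with \<open>L\<close> choices for \<open>s\<close>,
  the average measure of the cuts is \<open>O(1/L)\<close>, whatever the measure, and no invariance is required.
  A Borel coloring of the vertices by finitely many colors such that equally colored vertices are
  far apart makes it possible to perform a definite fraction of the augmentations simultaneously.

  Borelness of everything that is quantified over neighbours rests on the theorem that projections
  of Borel sets with sections of bounded size are Borel. It reduces to sections with at
  most one point (Lusin-Souslin), which follows from Lusin's separation of disjoint analytic sets.
\<close>

section \<open>Injective images of Borel sets\<close>

definition borel_separated :: "'a::topological_space set \<Rightarrow> 'a set \<Rightarrow> bool" where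
  "borel_separated A B \<longleftrightarrow> (\<exists>D\<in>sets borel. A \<subseteq> D \<and> D \<inter> B = {})"

text \<open>The separator is the union over \<open>i\<close> of the intersections over
  \<open>j\<close> of the given ones. It serves contrapositively: if two countable unions cannot be
  separated, then neither can some pair of their pieces.\<close>

lemma borel_separated_UN:
  fixes A B :: "nat \<Rightarrow> 'a::topological_space set"
  assumes "\<And>i j. borel_separated (A i) (B j)"
  shows "borel_separated (\<Union>i. A i) (\<Union>j. B j)"
proof -
  have "\<forall>i j. \<exists>D. D \<in> sets borel \<and> A i \<subseteq> D \<and> D \<inter> B j = {}"
    using assms unfolding borel_separated_def Bex_def by simp
  then obtain D where D: "\<And>i j. D i j \<in> sets borel" "\<And>i j. A i \<subseteq> D i j" "\<And>i j. D i j \<inter> B j = {}"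
    by metis
  show ?thesis unfolding borel_separated_def
  proof (intro bexI conjI)
    show "(\<Union>i. \<Inter>j. D i j) \<in> sets borel" using D(1)
      by (intro sets.countable_UN'' sets.countable_INT'') auto
    show "(\<Union>i. A i) \<subseteq> (\<Union>i. \<Inter>j. D i j)" using D(2) by blast
    show "(\<Union>i. \<Inter>j. D i j) \<inter> (\<Union>j. B j) = {}" using D(3) by blast
  qed
qed

lemma countable_cball_cover:
  obtains d :: "nat \<Rightarrow> 'a::{metric_space, second_countable_topology}"
  where "\<And>x e. e > 0 \<Longrightarrow> \<exists>i. x \<in> cball (d i) e"
proof -
  obtain D :: "'a set" where D: "countable D" "\<And>U. open U \<Longrightarrow> U \<noteq> {} \<Longrightarrow> \<exists>y\<in>D. y \<in> U"
    using countable_dense_setE by metis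
  have "D \<noteq> {}" using D(2)[of UNIV] by auto
  then obtain d :: "nat \<Rightarrow> 'a" where d: "D = range d"
    using D(1) uncountable_def by metis
  have "\<exists>i. x \<in> cball (d i) e" if "e > 0" for x e
  proof -
    have "\<exists>y\<in>D. y \<in> ball x e" by (rule D(2)) (use that in auto)
    then obtain y where "y \<in> D" "y \<in> ball x e" by blast
    then obtain i where "y = d i" unfolding d by blast
    then have "x \<in> cball (d i) e" using \<open>y \<in> ball x e\<close> by (simp add: dist_commute)
    then show ?thesis by blast
  qed
  then show thesis using that by blast
qed

text \<open>The sets need not be nested, so convergence is expressed as eventual containment in
  every ball around \<open>a\<close>. Since any two of them meet, the centres satisfy
  \<open>dist (d n) (d m) \<le> (1/2)^n + (1/2)^m\<close> and form a Cauchy sequence.\<close>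

lemma shrinking_closed_sets_limit:
  fixes A :: "nat \<Rightarrow> 'a::complete_space set"
  assumes cl: "\<And>n. closed (A n)" and ne: "\<And>n m. A n \<inter> A m \<noteq> {}"
    and d: "\<And>n. A n \<subseteq> cball (d n) ((1/2)^n)"
  obtains a where "\<And>e. e > 0 \<Longrightarrow> \<exists>N. \<forall>n\<ge>N. A n \<subseteq> ball a e"
proof -
  have dd: "dist (d n) (d m) \<le> (1/2)^n + (1/2)^m" for n m
  proof -
    obtain x where "x \<in> A n" "x \<in> A m" using ne by blast
    then have "x \<in> cball (d n) ((1/2)^n)" "x \<in> cball (d m) ((1/2)^m)" using d by blast+
    then have "dist (d n) x \<le> (1/2)^n" "dist (d m) x \<le> (1/2)^m" by auto
    then show ?thesis using dist_triangle2[of "d n" "d m" x] by linarith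
  qed
  have small: "\<exists>N. \<forall>n\<ge>N. (1/2)^n < e" if e: "e > 0" for e :: real
  proof -
    obtain N where N: "(1/2)^N < e" using real_arch_pow_inv[OF e, of "1/2"] by auto
    have "(1/2)^n < e" if "n \<ge> N" for n
      using power_decreasing[OF that, of "1/2::real"] N by linarith
    then show ?thesis by blast
  qed
  have "Cauchy d"
  proof (rule metric_CauchyI)
    fix e :: real assume "e > 0"
    then obtain N where N: "\<forall>n\<ge>N. (1/2)^n < e/2" using small[of "e/2"] by auto
    have "dist (d m) (d n) < e" if "m \<ge> N" "n \<ge> N" for m n
      using dd[of m n] N[rule_format, of m] N[rule_format, of n] that by linarith
    then show "\<exists>M. \<forall>m\<ge>M. \<forall>n\<ge>M. dist (d m) (d n) < e" by blast
  qed
  then obtain a where a: "d \<longlonglongrightarrow> a" using Cauchy_convergent convergent_def by blast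
  have "\<exists>N. \<forall>n\<ge>N. A n \<subseteq> ball a e" if e: "e > 0" for e
  proof -
    obtain N1 where N1: "\<forall>n\<ge>N1. (1/2)^n < e/2" using small[of "e/2"] e by auto
    obtain N2 where N2: "\<forall>n\<ge>N2. dist (d n) a < e/2"
      using a e unfolding LIMSEQ_def by (meson half_gt_zero)
    have "A n \<subseteq> ball a e" if "n \<ge> max N1 N2" for n
    proof
      fix x assume "x \<in> A n"
      then have "x \<in> cball (d n) ((1/2)^n)" using d by blast
      then have "dist (d n) x \<le> (1/2)^n" by auto
      then show "x \<in> ball a e"
        using N1[rule_format, of n] N2[rule_format, of n] that dist_triangle3[of a x "d n"] by auto
    qed
    then show ?thesis by blast
  qed
  then show thesis using that by blast
qed

lemma mem_of_shrinking_closed_sets: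
  fixes A :: "nat \<Rightarrow> 'a::metric_space set"
  assumes "closed C" "\<And>n. A n \<inter> C \<noteq> {}" "\<And>e. e > 0 \<Longrightarrow> \<exists>N. \<forall>n\<ge>N. A n \<subseteq> ball a e"
  shows "a \<in> C"
proof -
  have "\<exists>y\<in>C. dist y a < e" if e: "e > 0" for e
  proof -
    obtain N where "A N \<subseteq> ball a e" using assms(3)[OF e] by blast
    then show ?thesis using assms(2)[of N] by (auto simp: dist_commute)
  qed
  then show ?thesis using assms(1) by (metis closed_approachable)
qed

text \<open>If the images were not separated, both closed sets could be cut again and again into
  smaller closed pieces whose images are still not separated. The pieces shrink to points
  \<open>a\<close> in \<open>A\<close> and \<open>b\<close> in \<open>B\<close>; disjoint
  neighbourhoods of \<open>f a\<close> and \<open>f b\<close> then separate the images of late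
  pieces.\<close>

lemma closed_images_borel_separated:
  fixes f :: "'a::{complete_space, second_countable_topology} \<Rightarrow> 'b::t2_space"
  assumes f: "continuous_on UNIV f" and A: "closed A" and B: "closed B"
    and disj: "f ` A \<inter> f ` B = {}"
  shows "borel_separated (f ` A) (f ` B)"
proof (rule ccontr)
  assume nonsep: "\<not> ?thesis"
  obtain d :: "nat \<Rightarrow> 'a" where d: "\<And>x e. e > 0 \<Longrightarrow> \<exists>i. x \<in> cball (d i) e"
    using countable_cball_cover by metis
  \<comment> \<open>The disjunct \<open>n = 0\<close> exempts the initial sets \<open>A\<close> and
    \<open>B\<close>, which may be unbounded, from the radius bound.\<close>
  define P where "P = (\<lambda>n (X, Y). closed X \<and> closed Y \<and> \<not> borel_separated (f ` X) (f ` Y)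
    \<and> (\<exists>i. n = 0 \<or> X \<subseteq> cball (d i) ((1/2)^n)) \<and> (\<exists>i. n = 0 \<or> Y \<subseteq> cball (d i) ((1/2)^n)))"
  have step: "\<exists>s'. P (Suc n) s' \<and> (fst s' \<subseteq> fst s \<and> snd s' \<subseteq> snd s)" if Ps: "P n s" for n s
  proof -
    obtain X Y where s: "s = (X, Y)" by force
    let ?e = "(1/2::real)^Suc n"
    have e: "?e > 0" by simp
    define Xi where "Xi i = X \<inter> cball (d i) ?e" for i
    define Yi where "Yi i = Y \<inter> cball (d i) ?e" for i
    have U: "X = (\<Union>i. Xi i)" "Y = (\<Union>i. Yi i)" using d[OF e] unfolding Xi_def Yi_def by auto
    have "\<exists>i j. \<not> borel_separated (f ` Xi i) (f ` Yi j)"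
    proof (rule ccontr)
      assume "\<not> ?thesis"
      then have "borel_separated (\<Union>i. f ` Xi i) (\<Union>j. f ` Yi j)" by (intro borel_separated_UN) blast
      then show False using Ps unfolding s P_def by (subst (asm) U(1), subst (asm) U(2)) (simp add: image_UN)
    qed
    then obtain i j where "\<not> borel_separated (f ` Xi i) (f ` Yi j)" by blast
    then have "P (Suc n) (Xi i, Yi j)" using Ps unfolding s P_def Xi_def Yi_def by auto
    then show ?thesis unfolding s Xi_def Yi_def by (intro exI[of _ "(X \<inter> cball (d i) ?e, Y \<inter> cball (d j) ?e)"]) auto
  qed
  have "P 0 (A, B)" using A B nonsep unfolding P_def by simp
  then have "\<exists>s. \<forall>n. (P n (s n) \<and> (n = 0 \<longrightarrow> s n = (A, B))) \<and>
      (fst (s (Suc n)) \<subseteq> fst (s n) \<and> snd (s (Suc n)) \<subseteq> snd (s n))"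
    by (intro dependent_nat_choice[where P="\<lambda>n x. P n x \<and> (n = 0 \<longrightarrow> x = (A, B))"
          and Q="\<lambda>n x y. fst y \<subseteq> fst x \<and> snd y \<subseteq> snd x"]) (use step in auto)
  then obtain s where s: "\<And>n. P n (s n)" "\<And>n. fst (s (Suc n)) \<subseteq> fst (s n) \<and> snd (s (Suc n)) \<subseteq> snd (s n)"
      and s0: "s 0 = (A, B)" by blast
  define X where "X n = fst (s n)" for n
  define Y where "Y n = snd (s n)" for n
  have X0: "X 0 = A" "Y 0 = B" unfolding X_def Y_def s0 by auto
  have "X (Suc n) \<subseteq> X n" "Y (Suc n) \<subseteq> Y n" for n using s(2) unfolding X_def Y_def by auto
  then have decr: "m \<le> n \<Longrightarrow> X n \<subseteq> X m" "m \<le> n \<Longrightarrow> Y n \<subseteq> Y m" for m n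
    by (metis lift_Suc_antimono_le)+
  have PP: "closed (X n)" "closed (Y n)" "\<not> borel_separated (f ` X n) (f ` Y n)"
    "\<exists>i. n = 0 \<or> X n \<subseteq> cball i ((1/2)^n)" "\<exists>i. n = 0 \<or> Y n \<subseteq> cball i ((1/2)^n)" for n
    using s(1)[of n] unfolding P_def X_def Y_def by (auto simp: case_prod_unfold)
  have ne: "X n \<noteq> {}" "Y n \<noteq> {}" for n
    using PP(3)[of n] unfolding borel_separated_def
    by (metis Int_empty_left empty_subsetI image_empty sets.empty_sets)
      (metis Int_empty_right image_empty sets.top space_borel subset_UNIV PP(3) borel_separated_def)
  obtain dx where dx: "\<And>n. n = 0 \<or> X n \<subseteq> cball (dx n) ((1/2)^n)" using PP(4) by metis
  obtain dy where dy: "\<And>n. n = 0 \<or> Y n \<subseteq> cball (dy n) ((1/2)^n)" using PP(5) by metis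
  \<comment> \<open>The radius bounds start at index 1. After the shift, the radius at
    \<open>Suc n\<close> is relaxed to \<open>(1/2)^n\<close> to match the limit lemma.\<close>
  have sub: "X (Suc n) \<subseteq> cball (dx (Suc n)) ((1/2)^n)" "Y (Suc n) \<subseteq> cball (dy (Suc n)) ((1/2)^n)" for n
  proof -
    have "cball z ((1/2)^Suc n) \<subseteq> cball z ((1/2)^n)" for z :: 'a by (rule subset_cball) simp
    then show "X (Suc n) \<subseteq> cball (dx (Suc n)) ((1/2)^n)" "Y (Suc n) \<subseteq> cball (dy (Suc n)) ((1/2)^n)"
      using dx[of "Suc n"] dy[of "Suc n"] by blast+
  qed
  have int: "X (Suc n) \<inter> X (Suc m) \<noteq> {}" "Y (Suc n) \<inter> Y (Suc m) \<noteq> {}" for n m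
    using decr[of "Suc n" "Suc (max n m)"] decr[of "Suc m" "Suc (max n m)"] ne[of "Suc (max n m)"] by auto
  obtain a where a: "\<And>e. e > 0 \<Longrightarrow> \<exists>N. \<forall>n\<ge>N. X (Suc n) \<subseteq> ball a e"
    by (rule shrinking_closed_sets_limit[of "\<lambda>n. X (Suc n)"]) (use PP(1) int sub in blast)+
  obtain b where b: "\<And>e. e > 0 \<Longrightarrow> \<exists>N. \<forall>n\<ge>N. Y (Suc n) \<subseteq> ball b e"
    by (rule shrinking_closed_sets_limit[of "\<lambda>n. Y (Suc n)"]) (use PP(2) int sub in blast)+
  have "a \<in> A"
    by (rule mem_of_shrinking_closed_sets[OF A _ a]) (use decr(1)[of 0 "Suc _"] ne X0 in fastforce)
  moreover have "b \<in> B"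
    by (rule mem_of_shrinking_closed_sets[OF B _ b]) (use decr(2)[of 0 "Suc _"] ne X0 in fastforce)
  ultimately have "f a \<noteq> f b" using disj by auto
  then obtain U V where UV: "open U" "open V" "f a \<in> U" "f b \<in> V" "U \<inter> V = {}"
    using hausdorff by metis
  have "open (f -` U)" "open (f -` V)" using f UV by (auto simp: continuous_on_open_vimage)
  then obtain e1 e2 where e: "e1 > 0" "ball a e1 \<subseteq> f -` U" "e2 > 0" "ball b e2 \<subseteq> f -` V"
    using UV by (metis openE vimageI)
  obtain N1 N2 where N: "\<forall>n\<ge>N1. X (Suc n) \<subseteq> ball a e1" "\<forall>n\<ge>N2. Y (Suc n) \<subseteq> ball b e2"
    using a[OF e(1)] b[OF e(3)] by blast
  define n where "n = max N1 N2"
  have "f ` X (Suc n) \<subseteq> U" "f ` Y (Suc n) \<subseteq> V"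
  proof -
    have "X (Suc n) \<subseteq> ball a e1" "Y (Suc n) \<subseteq> ball b e2" using N unfolding n_def by simp_all
    then show "f ` X (Suc n) \<subseteq> U" "f ` Y (Suc n) \<subseteq> V"
      using e by (meson image_subset_iff_subset_vimage subset_trans)+
  qed
  then have "borel_separated (f ` X (Suc n)) (f ` Y (Suc n))"
    unfolding borel_separated_def using UV by (intro bexI[of _ U]) auto
  then show False using PP(3) by blast
qed

text \<open>\<open>C\<close> is covered at every scale \<open>(1/2)^n\<close> by pieces
  \<open>A (i, n)\<close>. By injectivity disjoint pieces have disjoint, hence separated, images, so
  the images have Borel hulls \<open>G\<close> that are disjoint for disjoint pieces. A point
  \<open>y\<close> in some hull at every scale selects pieces that pairwise meet; they shrink to a
  point of \<open>C\<close>, whose image is \<open>y\<close>.\<close>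

lemma closed_injective_image_borel:
  fixes f :: "'a::{complete_space, second_countable_topology} \<Rightarrow> 'b::metric_space"
  assumes f: "continuous_on UNIV f" and C: "closed C" and inj: "inj_on f C"
  shows "f ` C \<in> sets borel"
proof -
  obtain d :: "nat \<Rightarrow> 'a" where d: "\<And>x e. e > 0 \<Longrightarrow> \<exists>i. x \<in> cball (d i) e"
    using countable_cball_cover by metis
  define A where "A p = C \<inter> cball (d (fst p)) ((1/2)^snd p)" for p :: "nat \<times> nat"
  have clA: "closed (A p)" for p unfolding A_def using C by auto
  have "\<exists>D. D \<in> sets borel \<and> f ` A p \<subseteq> D \<and> (A p \<inter> A q = {} \<longrightarrow> D \<inter> f ` A q = {})" for p q
  proof (cases "A p \<inter> A q = {}")
    case True
    moreover have "f ` (A p \<inter> A q) = f ` A p \<inter> f ` A q"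
      by (rule inj_on_image_Int[OF inj]) (auto simp: A_def)
    ultimately have "f ` A p \<inter> f ` A q = {}" by simp
    then have "borel_separated (f ` A p) (f ` A q)"
      by (rule closed_images_borel_separated[OF f clA clA])
    then show ?thesis unfolding borel_separated_def by metis
  next
    case False
    then show ?thesis by (intro exI[of _ UNIV]) auto
  qed
  then obtain D where D: "\<And>p q. D p q \<in> sets borel" "\<And>p q. f ` A p \<subseteq> D p q"
      "\<And>p q. A p \<inter> A q = {} \<Longrightarrow> D p q \<inter> f ` A q = {}" by metis
  \<comment> \<open>Removing \<open>D q p\<close> makes the hulls of disjoint pieces disjoint; the
    closure ties a point of the hulls to the value of \<open>f\<close> at the limit of the
    pieces.\<close>
  define G where "G p = (\<Inter>q. D p q \<inter> (if A p \<inter> A q = {} then - D q p else UNIV)) \<inter> closure (f ` A p)" for p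
  have Gb: "G p \<in> sets borel" for p unfolding G_def using D(1)
    by (intro sets.Int sets.countable_INT'') (auto intro: borel_comp)
  have GA: "f ` A p \<subseteq> G p" for p
  proof -
    have "f ` A p \<subseteq> closure (f ` A p)" by (rule closure_subset)
    moreover have "f ` A p \<subseteq> D p q \<inter> (if A p \<inter> A q = {} then - D q p else UNIV)" for q
    proof (cases "A p \<inter> A q = {}")
      case True
      then have "D q p \<inter> f ` A p = {}" by (intro D(3)) (simp add: Int_commute)
      then have "f ` A p \<subseteq> - D q p" by blast
      then show ?thesis using D(2)[of p q] True by simp
    next
      case False
      then show ?thesis using D(2)[of p q] by simp
    qed
    ultimately show ?thesis unfolding G_def by (intro Int_greatest[OF INT_greatest])
  qed
  have GG: "A p \<inter> A q \<noteq> {}" if "y \<in> G p" "y \<in> G q" for p q y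
  proof
    assume "A p \<inter> A q = {}"
    moreover have "y \<in> D p q \<inter> (if A p \<inter> A q = {} then - D q p else UNIV)"
      using that(1) unfolding G_def by blast
    ultimately have "y \<in> - D q p" by simp
    moreover have "y \<in> D q p" using that(2) unfolding G_def by blast
    ultimately show False by blast
  qed
  have "f ` C = (\<Inter>n. \<Union>i. G (i, n))"
  proof
    show "f ` C \<subseteq> (\<Inter>n. \<Union>i. G (i, n))"
    proof clarify
      fix x n assume "x \<in> C"
      obtain i where "x \<in> cball (d i) ((1/2)^n)" using d[of "(1/2)^n"] by auto
      then have "x \<in> A (i, n)" unfolding A_def using \<open>x \<in> C\<close> by auto
      then show "f x \<in> (\<Union>i. G (i, n))" using GA by blast
    qed
    show "(\<Inter>n. \<Union>i. G (i, n)) \<subseteq> f ` C"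
    proof
      fix y assume "y \<in> (\<Inter>n. \<Union>i. G (i, n))"
      then have "\<forall>n. \<exists>i. y \<in> G (i, n)" by blast
      then obtain i where i: "\<And>n. y \<in> G (i n, n)" by metis
      have ne: "A (i n, n) \<inter> A (i m, m) \<noteq> {}" for n m using GG i by blast
      obtain a where a: "\<And>e. e > 0 \<Longrightarrow> \<exists>N. \<forall>n\<ge>N. A (i n, n) \<subseteq> ball a e"
        by (rule shrinking_closed_sets_limit[of "\<lambda>n. A (i n, n)" "\<lambda>n. d (i n)"])
          (use clA ne in \<open>auto simp: A_def\<close>)
      have "a \<in> C"
        by (rule mem_of_shrinking_closed_sets[OF C _ a]) (use ne in \<open>auto simp: A_def\<close>)
      moreover have "f a = y"
      proof (rule ccontr)
        assume "f a \<noteq> y"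
        \<comment> \<open>Half the distance keeps \<open>y\<close> out of the closed ball of radius
          \<open>e\<close> around \<open>f a\<close>, which contains the closure of the image of a
          small piece.\<close>
        define e where "e = dist (f a) y / 2"
        have e: "e > 0" using \<open>f a \<noteq> y\<close> unfolding e_def by auto
        have "open (f -` ball (f a) e)" using f by (auto simp: continuous_on_open_vimage)
        moreover have "a \<in> f -` ball (f a) e" using e by simp
        ultimately obtain r where r: "r > 0" "ball a r \<subseteq> f -` ball (f a) e"
          by (rule openE)
        obtain N where "A (i N, N) \<subseteq> ball a r" using a[OF r(1)] by blast
        then have "f ` A (i N, N) \<subseteq> cball (f a) e" using r by force
        then have "closure (f ` A (i N, N)) \<subseteq> cball (f a) e" by (rule closure_minimal) simp
        then have "y \<in> cball (f a) e" using i[of N] unfolding G_def by auto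
        then show False using e unfolding e_def by auto
      qed
      ultimately show "y \<in> f ` C" by blast
    qed
  qed
  moreover have "(\<Inter>n. \<Union>i. G (i, n)) \<in> sets borel" using Gb by auto
  ultimately show ?thesis by simp
qed

text \<open>Borel sets turn out to be injective projections of closed sets. Witnesses are taken in
  \<^typ>\<open>nat \<Rightarrow> real\<close> instead of Baire space: a single real \<^term>\<open>w\<close> with
  \<open>w * infdist z (- U) = 1\<close> is then a unique witness of membership in an open set.\<close>

definition uniquely_witnessed :: "'a::topological_space set \<Rightarrow> bool" where
  "uniquely_witnessed B \<longleftrightarrow>
     (\<exists>C :: ('a \<times> (nat \<Rightarrow> real)) set. closed C \<and> inj_on fst C \<and> fst ` C = B)"

lemma uniquely_witnessedI:
  fixes C :: "('a::topological_space \<times> (nat \<Rightarrow> real)) set"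
  assumes "closed C" "\<And>z w w'. (z, w) \<in> C \<Longrightarrow> (z, w') \<in> C \<Longrightarrow> w = w'"
    "\<And>z. z \<in> B \<longleftrightarrow> (\<exists>w. (z, w) \<in> C)"
  shows "uniquely_witnessed B"
  unfolding uniquely_witnessed_def
  by (rule exI[of _ C]) (use assms in \<open>auto simp: inj_on_def image_iff Bex_def\<close>)

lemma uniquely_witnessedE:
  fixes B :: "'a::topological_space set"
  assumes "uniquely_witnessed B"
  obtains C :: "('a \<times> (nat \<Rightarrow> real)) set" where "closed C"
    "\<And>z w w'. (z, w) \<in> C \<Longrightarrow> (z, w') \<in> C \<Longrightarrow> w = w'"
    "\<And>z. z \<in> B \<longleftrightarrow> (\<exists>w. (z, w) \<in> C)"
proof -
  obtain C :: "('a \<times> (nat \<Rightarrow> real)) set" where "closed C" "inj_on fst C" "fst ` C = B"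
    using assms unfolding uniquely_witnessed_def by blast
  then show thesis using that[of C] by (force simp: inj_on_def)
qed

lemma snd_coordinate_continuous:
  "continuous_on S (\<lambda>p :: 'a::topological_space \<times> ('i \<Rightarrow> 'b::topological_space). snd p i)"
  by (rule continuous_on_product_then_coordinatewise) (intro continuous_intros)

lemma uniquely_witnessed_open:
  fixes U :: "'a::metric_space set"
  assumes "open U"
  shows "uniquely_witnessed U"
proof (cases "U = UNIV")
  \<comment> \<open>The distance to an empty complement is 0 by convention, so the equation used for
    other open sets cannot serve here.\<close>
  case True
  have cl: "closed {p :: 'a \<times> (nat \<Rightarrow> real). snd p = (\<lambda>_. 0)}"
    by (intro closed_Collect_eq continuous_intros)
  show ?thesis by (rule uniquely_witnessedI[OF cl]) (auto simp: True)
next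
  case False
  define g where "g z = infdist z (- U)" for z
  have g: "z \<in> U \<longleftrightarrow> g z \<noteq> 0" for z
    using in_closed_iff_infdist_zero[of "- U" z] assms False unfolding g_def by auto
  \<comment> \<open>Constancy of the sequence leaves \<open>1 / g z\<close> as the only witness;
    stating this as a product keeps the condition closed although the witness blows up towards the
    boundary of \<open>U\<close>.\<close>
  define C where "C = {p :: 'a \<times> (nat \<Rightarrow> real). snd p = (\<lambda>_. snd p 0) \<and> g (fst p) * snd p 0 = 1}"
  have cl: "closed C" unfolding C_def g_def
    by (intro closed_Collect_conj closed_Collect_eq continuous_intros continuous_on_coordinatewise_then_product snd_coordinate_continuous)
  show ?thesis
  proof (rule uniquely_witnessedI[OF cl])
    show "w = w'" if "(z, w) \<in> C" "(z, w') \<in> C" for z w w'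
    proof -
      have 1: "w = (\<lambda>_. w 0)" "w' = (\<lambda>_. w' 0)" "g z * w 0 = 1" "g z * w' 0 = 1"
        using that unfolding C_def by auto
      then have "w 0 = w' 0" by (metis mult_cancel_left mult_zero_left zero_neq_one)
      then show ?thesis using 1 by metis
    qed
    show "z \<in> U \<longleftrightarrow> (\<exists>w. (z, w) \<in> C)" for z
    proof
      assume "z \<in> U"
      then show "\<exists>w. (z, w) \<in> C" unfolding g C_def by (intro exI[of _ "\<lambda>_. 1 / g z"]) auto
    next
      assume "\<exists>w. (z, w) \<in> C"
      then show "z \<in> U" unfolding g C_def by auto
    qed
  qed
qed

lemma uniquely_witnessed_closed:
  fixes U :: "'a::topological_space set"
  assumes "closed U"
  shows "uniquely_witnessed U"
proof -
  have cl: "closed (U \<times> {\<lambda>_. 0 :: real} :: ('a \<times> (nat \<Rightarrow> real)) set)"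
    by (intro closed_Times assms) auto
  show ?thesis by (rule uniquely_witnessedI[OF cl]) auto
qed

text \<open>One sequence codes countably many through \<open>prod_encode\<close>, so witnesses for
  all the \<open>B n\<close> merge into a single one, unique because each component is.\<close>

lemma uniquely_witnessed_INT:
  fixes B :: "nat \<Rightarrow> 'a::metric_space set"
  assumes "\<And>n. uniquely_witnessed (B n)"
  shows "uniquely_witnessed (\<Inter>n. B n)"
proof -
  have "\<forall>n. \<exists>C :: ('a \<times> (nat \<Rightarrow> real)) set. closed C \<and> (\<forall>z w w'. (z, w) \<in> C \<longrightarrow> (z, w') \<in> C \<longrightarrow> w = w')
      \<and> (\<forall>z. z \<in> B n \<longleftrightarrow> (\<exists>w. (z, w) \<in> C))"
    using assms by (meson uniquely_witnessedE)
  then obtain C :: "nat \<Rightarrow> ('a \<times> (nat \<Rightarrow> real)) set" where C: "\<And>n. closed (C n)"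
      "\<And>n z w w'. (z, w) \<in> C n \<Longrightarrow> (z, w') \<in> C n \<Longrightarrow> w = w'"
      "\<And>n z. z \<in> B n \<longleftrightarrow> (\<exists>w. (z, w) \<in> C n)" by metis
  define h where "h n p = (fst p, \<lambda>m. snd p (prod_encode (n, m)))" for n and p :: "'a \<times> (nat \<Rightarrow> real)"
  have h: "continuous_on UNIV (h n)" for n unfolding h_def
    by (intro continuous_on_Pair continuous_on_coordinatewise_then_product snd_coordinate_continuous continuous_intros)
  define K where "K = (\<Inter>n. h n -` C n)"
  have cl: "closed K" unfolding K_def by (intro closed_INT ballI closed_vimage[OF C(1) h])
  show ?thesis
  proof (rule uniquely_witnessedI[OF cl])
    show "w = w'" if "(z, w) \<in> K" "(z, w') \<in> K" for z w w'
    proof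
      fix i
      obtain n m where i: "i = prod_encode (n, m)" by (metis prod_encode_eq prod_decode_inverse surj_pair)
      have "(\<lambda>m. w (prod_encode (n, m))) = (\<lambda>m. w' (prod_encode (n, m)))"
        using that C(2)[of z _ n] unfolding K_def h_def by auto
      then show "w i = w' i" unfolding i by metis
    qed
    show "z \<in> (\<Inter>n. B n) \<longleftrightarrow> (\<exists>w. (z, w) \<in> K)" for z
    proof
      assume "z \<in> (\<Inter>n. B n)"
      then obtain w where w: "\<And>n. (z, w n) \<in> C n" using C(3) by (metis INT_iff UNIV_I)
      have "(z, \<lambda>i. w (fst (prod_decode i)) (snd (prod_decode i))) \<in> K" using w unfolding K_def h_def by auto
      then show "\<exists>w. (z, w) \<in> K" by blast
    next
      assume "\<exists>w. (z, w) \<in> K"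
      then show "z \<in> (\<Inter>n. B n)" unfolding K_def h_def using C(3) by auto
    qed
  qed
qed

lemma uniquely_witnessed_Int:
  fixes A B :: "'a::metric_space set"
  assumes "uniquely_witnessed A" "uniquely_witnessed B"
  shows "uniquely_witnessed (A \<inter> B)"
proof -
  have "uniquely_witnessed (\<Inter>n. if n = (0::nat) then A else B)"
    by (rule uniquely_witnessed_INT) (use assms in auto)
  moreover have "(\<Inter>n. if n = (0::nat) then A else B) = A \<inter> B" by (auto split: if_splits)
  ultimately show ?thesis by simp
qed

text \<open>Coordinate 0 of the witness records the index \<open>n\<close>, the remaining
  coordinates witness membership in \<open>B n\<close>. Disjointness makes the index unique.\<close>

lemma uniquely_witnessed_disjoint_UN:
  fixes B :: "nat \<Rightarrow> 'a::metric_space set"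
  assumes "\<And>n. uniquely_witnessed (B n)" and disj: "disjoint_family B"
  shows "uniquely_witnessed (\<Union>n. B n)"
proof -
  have "\<forall>n. \<exists>C :: ('a \<times> (nat \<Rightarrow> real)) set. closed C \<and> (\<forall>z w w'. (z, w) \<in> C \<longrightarrow> (z, w') \<in> C \<longrightarrow> w = w')
      \<and> (\<forall>z. z \<in> B n \<longleftrightarrow> (\<exists>w. (z, w) \<in> C))"
    using assms by (meson uniquely_witnessedE)
  then obtain C :: "nat \<Rightarrow> ('a \<times> (nat \<Rightarrow> real)) set" where C: "\<And>n. closed (C n)"
      "\<And>n z w w'. (z, w) \<in> C n \<Longrightarrow> (z, w') \<in> C n \<Longrightarrow> w = w'"
      "\<And>n z. z \<in> B n \<longleftrightarrow> (\<exists>w. (z, w) \<in> C n)" by metis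
  define h where "h p = (fst p, \<lambda>m. snd p (Suc m))" for p :: "'a \<times> (nat \<Rightarrow> real)"
  have h: "continuous_on UNIV h" unfolding h_def
    by (intro continuous_on_Pair continuous_on_coordinatewise_then_product snd_coordinate_continuous continuous_intros)
  define K where "K = (\<Union>n. {p. snd p 0 = real n} \<inter> h -` C n)"
  define L where "L n = {p. snd p 0 = real n} \<inter> h -` C n" for n
  have clL: "closed (L n)" for n unfolding L_def
    by (intro closed_Int closed_Collect_eq snd_coordinate_continuous continuous_on_const closed_vimage[OF C(1) h])
  \<comment> \<open>The infinite union is closed because \<open>L n\<close> sits at height
    \<open>n\<close> of coordinate 0: below height \<open>N\<close> only finitely many of these sets
    occur.\<close>
  have KL: "K = (\<Inter>N. {p. real N \<le> snd p 0} \<union> (\<Union>n<N. L n))"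
  proof
    show "K \<subseteq> (\<Inter>N. {p. real N \<le> snd p 0} \<union> (\<Union>n<N. L n))"
      unfolding K_def L_def by (auto simp: not_le)
    show "(\<Inter>N. {p. real N \<le> snd p 0} \<union> (\<Union>n<N. L n)) \<subseteq> K"
    proof
      fix p assume p: "p \<in> (\<Inter>N. {p. real N \<le> snd p 0} \<union> (\<Union>n<N. L n))"
      obtain N where "snd p 0 < real N" using reals_Archimedean2 by blast
      moreover have "p \<in> {p. real N \<le> snd p 0} \<union> (\<Union>n<N. L n)" using p by (rule INT_D) simp
      ultimately have "p \<in> (\<Union>n<N. L n)" by simp
      then show "p \<in> K" unfolding K_def L_def by blast
    qed
  qed
  have cl: "closed K" unfolding KL
  proof (intro closed_INT ballI closed_Un)
    fix N :: nat
    show "closed {p :: 'a \<times> (nat \<Rightarrow> real). real N \<le> snd p 0}"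
      by (intro closed_Collect_le snd_coordinate_continuous continuous_on_const)
    show "closed (\<Union>n<N. L n)" using clL by auto
  qed
  show ?thesis
  proof (rule uniquely_witnessedI[OF cl])
    show "w = w'" if "(z, w) \<in> K" "(z, w') \<in> K" for z w w'
    proof -
      obtain n m where n: "w 0 = real n" "(z, \<lambda>i. w (Suc i)) \<in> C n" "w' 0 = real m" "(z, \<lambda>i. w' (Suc i)) \<in> C m"
        using \<open>(z, w) \<in> K\<close> \<open>(z, w') \<in> K\<close> unfolding K_def h_def by auto
      then have "z \<in> B n" "z \<in> B m" using C(3) by blast+
      then have "n = m" using disj unfolding disjoint_family_on_def by blast
      then have "(\<lambda>i. w (Suc i)) = (\<lambda>i. w' (Suc i))" "w 0 = w' 0" using n C(2) by auto
      then show ?thesis by (metis not0_implies_Suc ext)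
    qed
    show "z \<in> (\<Union>n. B n) \<longleftrightarrow> (\<exists>w. (z, w) \<in> K)" for z
    proof
      assume "z \<in> (\<Union>n. B n)"
      then obtain n w where w: "(z, w) \<in> C n" using C(3) by blast
      then have "(z, \<lambda>i. case i of 0 \<Rightarrow> real n | Suc i \<Rightarrow> w i) \<in> K" unfolding K_def h_def by auto
      then show "\<exists>w. (z, w) \<in> K" by blast
    next
      assume "\<exists>w. (z, w) \<in> K"
      then show "z \<in> (\<Union>n. B n)" unfolding K_def h_def using C(3) by auto
    qed
  qed
qed

text \<open>The induction carries the complement along: unions are handled only for disjoint
  families, and \<open>disjointed\<close> intersects each set with the complements of the earlier
  ones.\<close>

lemma uniquely_witnessed_borel:
  fixes B :: "'a::metric_space set"
  assumes "B \<in> sets borel"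
  shows "uniquely_witnessed B"
proof -
  have "B \<in> sigma_sets UNIV {S. open S}" using assms by (simp add: borel_def)
  then have "uniquely_witnessed B \<and> uniquely_witnessed (- B)"
  proof (induction rule: sigma_sets.induct)
    case (Basic S)
    then show ?case by (simp add: uniquely_witnessed_open uniquely_witnessed_closed closed_Compl)
  next
    case Empty
    then show ?case using uniquely_witnessed_closed by auto
  next
    case (Compl S)
    then show ?case by (simp add: Compl_eq_Diff_UNIV double_complement Diff_Diff_Int)
  next
    case (Union S)
    have fin: "uniquely_witnessed (\<Inter>i\<in>{..<n}. - S i)" for n :: nat
    proof (induction n)
      case 0
      then show ?case using uniquely_witnessed_closed by auto
    next
      case (Suc n)
      then show ?case using Union uniquely_witnessed_Int by (auto simp: lessThan_Suc)
    qed
    have "disjointed S n = S n \<inter> (\<Inter>i\<in>{..<n}. - S i)" for n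
      unfolding disjointed_def by auto
    then have "uniquely_witnessed (disjointed S n)" for n
      using fin[of n] Union(2)[of n] by (simp add: uniquely_witnessed_Int)
    then have "uniquely_witnessed (\<Union>n. disjointed S n)"
      using disjoint_family_disjointed by (rule uniquely_witnessed_disjoint_UN)
    moreover have "- (\<Union>i. S i) = (\<Inter>i. - S i)" by auto
    ultimately show ?case using Union uniquely_witnessed_INT[of "\<lambda>i. - S i"] by (auto simp: UN_disjointed_eq)
  qed
  then show ?thesis by simp
qed

section \<open>The Lusin-Souslin theorem and its form for projections\<close>

theorem continuous_injective_image_borel:
  fixes f :: "'a::{complete_space, second_countable_topology} \<Rightarrow> 'b::metric_space"
  assumes f: "continuous_on UNIV f" and B: "B \<in> sets borel" and inj: "inj_on f B"
  shows "f ` B \<in> sets borel"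
proof -
  obtain C :: "('a \<times> (nat \<Rightarrow> real)) set" where C: "closed C" "inj_on fst C" "fst ` C = B"
    using uniquely_witnessed_borel[OF B] unfolding uniquely_witnessed_def by blast
  \<comment> \<open>\<open>C\<close> is a closed set in a larger complete space, and the composed
    map is injective on it, so the closed case applies.\<close>
  have "(f \<circ> fst) ` C \<in> sets borel"
  proof (rule closed_injective_image_borel)
    show "continuous_on UNIV (f \<circ> (fst :: 'a \<times> (nat \<Rightarrow> real) \<Rightarrow> 'a))"
      by (intro continuous_on_compose continuous_intros continuous_on_subset[OF f]) auto
    show "inj_on (f \<circ> fst) C" using C inj by (auto intro: comp_inj_on)
  qed fact
  then show ?thesis using C(3) by (metis image_comp)
qed

lemma unique_section_projection_borel:
  fixes B :: "('a::{complete_space, second_countable_topology} \<times> 'b::{complete_space, second_countable_topology}) set"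
  assumes "B \<in> sets borel" "\<And>x y y'. (x, y) \<in> B \<Longrightarrow> (x, y') \<in> B \<Longrightarrow> y = y'"
  shows "Domain B \<in> sets borel"
proof -
  have "inj_on fst B" using assms(2) by (auto simp: inj_on_def)
  then have "fst ` B \<in> sets borel"
    using assms(1) continuous_on_fst[OF continuous_on_id] by (intro continuous_injective_image_borel)
  then show ?thesis by (simp add: Domain_fst)
qed

section \<open>Projections of Borel sets with bounded sections\<close>

lemma finite_set_separated_by_basis:
  fixes S :: "'b::metric_space set"
  assumes "finite S" "topological_basis \<B>"
  obtains U where "\<And>a. a \<in> S \<Longrightarrow> U a \<in> \<B> \<and> a \<in> U a"
    "\<And>a b. a \<in> S \<Longrightarrow> b \<in> S \<Longrightarrow> a \<noteq> b \<Longrightarrow> U a \<inter> U b = {}"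
proof -
  \<comment> \<open>The extra element 1 keeps the minimum defined and positive when \<open>S\<close>
    has no two distinct points.\<close>
  define M where "M = insert 1 ((\<lambda>(a, b). dist a b) ` {p \<in> S \<times> S. fst p \<noteq> snd p})"
  have fin: "finite M" unfolding M_def using assms(1) by auto
  define r where "r = Min M / 2"
  have pos: "m > 0" if "m \<in> M" for m using that unfolding M_def by auto
  have r: "r > 0" unfolding r_def using fin pos[of "Min M"] Min_in[of M] by (auto simp: M_def)
  have rr: "2 * r \<le> dist a b" if "a \<in> S" "b \<in> S" "a \<noteq> b" for a b
  proof -
    have "dist a b \<in> M" unfolding M_def using that by force
    then show ?thesis unfolding r_def using Min_le[OF fin] by simp
  qed
  have "\<exists>U. U \<in> \<B> \<and> a \<in> U \<and> U \<subseteq> ball a r" for a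
    using topological_basisE[OF assms(2), of "ball a r" a] r by (metis centre_in_ball open_ball)
  then obtain U where U: "\<And>a. U a \<in> \<B> \<and> a \<in> U a \<and> U a \<subseteq> ball a r" by metis
  have "U a \<inter> U b = {}" if "a \<in> S" "b \<in> S" "a \<noteq> b" for a b
  proof -
    have "ball a r \<inter> ball b r = {}" by (rule disjoint_ballI) (use rr[OF that] in auto)
    then show ?thesis using U by blast
  qed
  then show thesis using that U by blast
qed

theorem bounded_section_projection_borel:
  fixes B :: "('a::{complete_space, second_countable_topology} \<times> 'b::{complete_space, second_countable_topology}) set"
  assumes "B \<in> sets borel" "\<And>x. finite (B `` {x}) \<and> card (B `` {x}) \<le> k"
  shows "Domain B \<in> sets borel"
  using assms
proof (induction k arbitrary: B)
  case 0
  then have "B `` {x} = {}" for x using card_0_eq[of "B `` {x}"] by simp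
  then have "B = {}" by auto
  then show ?case by simp
next
  case (Suc k)
  \<comment> \<open>The points whose section has the maximal size \<open>n\<close> are those whose section meets each of
    some disjoint basic open sets \<open>U 0, ..., U (n - 1)\<close>; for fixed \<open>U\<close> the tuple of intersection
    points is unique, up to the irrelevant entries from \<open>n\<close> on.\<close>
  define n where "n = Suc k"
  obtain \<B> :: "'b set set" where \<B>: "countable \<B>" "topological_basis \<B>" using ex_countable_basis by metis
  define \<T> where "\<T> = {U \<in> {..<n} \<rightarrow>\<^sub>E \<B>. \<forall>i<n. \<forall>j<n. i \<noteq> j \<longrightarrow> U i \<inter> U j = {}}"
  define T where "T U = {p :: 'a \<times> (nat \<Rightarrow> 'b). (\<forall>i<n. snd p i \<in> U i \<and> (fst p, snd p i) \<in> B)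
    \<and> (\<forall>i. n \<le> i \<longrightarrow> snd p i = snd p 0)}" for U
  define A where "A = (\<Union>U\<in>\<T>. Domain (T U))"
  have "countable ({..<n} \<rightarrow>\<^sub>E \<B>)" using \<B>(1) by (intro countable_PiE) auto
  then have cT: "countable \<T>" unfolding \<T>_def by (rule countable_subset[rotated]) auto
  have TB: "T U \<in> sets borel" if "U \<in> \<T>" for U
  proof -
    have o: "open (U i)" if "i < n" for i
      using \<open>U \<in> \<T>\<close> that \<B>(2) unfolding \<T>_def by (auto intro: topological_basis_open)
    have 1: "(\<lambda>p. snd p i) -` U i \<in> sets (borel :: ('a \<times> (nat \<Rightarrow> 'b)) measure)" if "i < n" for i
      by (rule borel_open, rule open_vimage[OF o[OF that] snd_coordinate_continuous])
    have 2: "(\<lambda>p. (fst p, snd p i)) -` B \<in> sets (borel :: ('a \<times> (nat \<Rightarrow> 'b)) measure)" for i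
      by (rule measurable_sets_borel[OF _ Suc.prems(1)], rule borel_measurable_continuous_onI)
        (intro continuous_on_Pair snd_coordinate_continuous continuous_intros)
    have 3: "{p. snd p i = snd p 0} \<in> sets (borel :: ('a \<times> (nat \<Rightarrow> 'b)) measure)" for i
      by (rule borel_closed, intro closed_Collect_eq snd_coordinate_continuous)
    define W where "W i = (if i < n then (\<lambda>p. snd p i) -` U i \<inter> (\<lambda>p. (fst p, snd p i)) -` B
        else {p. snd p i = snd p 0})" for i
    have W: "p \<in> W i \<longleftrightarrow> (i < n \<longrightarrow> snd p i \<in> U i \<and> (fst p, snd p i) \<in> B) \<and> (n \<le> i \<longrightarrow> snd p i = snd p 0)" for p i
      unfolding W_def by simp
    have "T U = (\<Inter>i. W i)" unfolding T_def INT_iff set_eq_iff W mem_Collect_eq by blast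
    also have "\<dots> \<in> sets borel" using 1 2 3 unfolding W_def by (intro sets.countable_INT'') simp_all
    finally show ?thesis .
  qed
  have Tinj: "y i = y' i" if U: "U \<in> \<T>" and y: "(x, y) \<in> T U" and y': "(x, y') \<in> T U" and i: "i < n" for x y y' U i
  proof (rule ccontr)
    assume ne: "y i \<noteq> y' i"
    \<comment> \<open>\<open>y' i\<close> lies in \<open>U i\<close> and differs from
      \<open>y i\<close>, so together with \<open>y 0\<close>, ..., \<open>y (n - 1)\<close> it
      would yield \<open>n + 1\<close> points in one section.\<close>
    define z where "z j = (if j < n then y j else y' i)" for j
    have m: "y j \<in> U j" "y' j \<in> U j" if "j < n" for j using y y' that unfolding T_def by auto
    have disj: "U j \<inter> U l = {}" if "j < n" "l < n" "j \<noteq> l" for j l using U that unfolding \<T>_def by auto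
    have "inj_on z {..n}"
    proof (rule inj_onI)
      fix j l assume jl: "j \<in> {..n}" "l \<in> {..n}" "z j = z l"
      show "j = l"
      proof (cases "j = n \<or> l = n")
        case True
        then show ?thesis using jl ne m i disj[of i] unfolding z_def
          by (auto split: if_splits) (metis disjoint_iff)+
      next
        case False
        then have "j < n" "l < n" using jl by auto
        then show ?thesis using jl(3) m(1)[of j] m(1)[of l] disj[of j l] unfolding z_def by auto
      qed
    qed
    then have "card (z ` {..n}) = Suc n" by (simp add: card_image)
    moreover have "z ` {..n} \<subseteq> B `` {x}" using y y' i unfolding T_def z_def by auto
    ultimately have "Suc n \<le> card (B `` {x})" using Suc.prems(2)[of x] by (metis card_mono)
    then show False using Suc.prems(2)[of x] unfolding n_def by simp
  qed
  have "Domain (T U) \<in> sets borel" if U: "U \<in> \<T>" for U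
  proof (rule unique_section_projection_borel[OF TB[OF U]])
    fix x y y' assume y: "(x, y) \<in> T U" "(x, y') \<in> T U"
    have "y i = y' i" for i
    proof (cases "i < n")
      case True then show ?thesis using Tinj[OF U y] by blast
    next
      case False
      then have "y i = y 0" "y' i = y' 0" using y unfolding T_def by auto
      then show ?thesis using Tinj[OF U y, of 0] n_def by simp
    qed
    then show "y = y'" by blast
  qed
  then have A: "A \<in> sets borel" unfolding A_def using cT by (intro sets.countable_UN') auto
  have A_eq: "x \<in> A" if "card (B `` {x}) = n" for x
  proof -
    obtain U where U: "\<And>a. a \<in> B `` {x} \<Longrightarrow> U a \<in> \<B> \<and> a \<in> U a"
      "\<And>a b. a \<in> B `` {x} \<Longrightarrow> b \<in> B `` {x} \<Longrightarrow> a \<noteq> b \<Longrightarrow> U a \<inter> U b = {}"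
      using finite_set_separated_by_basis[of "B `` {x}" \<B>] Suc.prems(2)[of x] \<B>(2) by metis
    obtain y where y: "bij_betw y {..<n} (B `` {x})"
      using ex_bij_betw_nat_finite[of "B `` {x}"] Suc.prems(2)[of x] \<open>card (B `` {x}) = n\<close>
      by (auto simp: atLeast0LessThan)
    have yB: "y i \<in> B `` {x}" if "i < n" for i using y that by (auto simp: bij_betw_def)
    have yi: "y i \<noteq> y j" if "i < n" "j < n" "i \<noteq> j" for i j
      using y that unfolding bij_betw_def inj_on_def by blast
    define V where "V = (\<lambda>i\<in>{..<n}. U (y i))"
    have "V \<in> \<T>" unfolding \<T>_def V_def using U yB yi by auto
    moreover have "(x, \<lambda>i. if i < n then y i else y 0) \<in> T V"
      using yB U unfolding T_def V_def n_def by auto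
    ultimately show ?thesis unfolding A_def by blast
  qed
  \<comment> \<open>Discarding the points whose section has size \<open>Suc k\<close> leaves
    sections of size at most \<open>k\<close>, to which the induction hypothesis applies.\<close>
  define B' where "B' = B - A \<times> UNIV"
  have "A \<times> (UNIV :: 'b set) \<in> sets borel" using A by (metis borel_prod pair_measureI sets.top space_borel)
  then have "B' \<in> sets borel" unfolding B'_def using Suc.prems(1) by blast
  moreover have "finite (B' `` {x}) \<and> card (B' `` {x}) \<le> k" for x
  proof (cases "x \<in> A")
    case True
    then have "B' `` {x} = {}" unfolding B'_def by auto
    then show ?thesis by simp
  next
    case False
    then have "B' `` {x} = B `` {x}" unfolding B'_def by auto
    then show ?thesis using Suc.prems(2)[of x] A_eq[of x] False unfolding n_def by (auto simp: le_Suc_eq)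
  qed
  ultimately have "Domain B' \<in> sets borel" by (rule Suc.IH)
  moreover have "Domain B = A \<union> Domain B'"
  proof -
    have "A \<subseteq> Domain B" 
    proof
      fix x assume "x \<in> A"
      then obtain U y where "(x, y) \<in> T U" unfolding A_def by blast
      then have "(x, y 0) \<in> B" unfolding T_def n_def by simp
      then show "x \<in> Domain B" by blast
    qed
    then show ?thesis unfolding B'_def by auto
  qed
  ultimately show ?case using A by auto
qed

section \<open>Borel vertex colorings\<close>

definition bounded_borel_rel :: "nat \<Rightarrow> ('a::polish_space \<times> 'a) set \<Rightarrow> bool" where
  "bounded_borel_rel d H \<longleftrightarrow> H \<in> sets borel \<and> (\<forall>x. finite (H `` {x}) \<and> card (H `` {x}) \<le> d)"

lemma bounded_borel_rel_subset:
  assumes "bounded_borel_rel d H" "G \<subseteq> H" "G \<in> sets borel"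
  shows "bounded_borel_rel d G"
proof -
  have "finite (G `` {x}) \<and> card (G `` {x}) \<le> d" for x
  proof -
    have "G `` {x} \<subseteq> H `` {x}" "finite (H `` {x})" "card (H `` {x}) \<le> d"
      using assms unfolding bounded_borel_rel_def by auto
    then show ?thesis by (meson card_mono finite_subset order_trans)
  qed
  then show ?thesis using assms(3) unfolding bounded_borel_rel_def by blast
qed

lemma bounded_borel_rel_Domain:
  assumes "bounded_borel_rel d H"
  shows "Domain H \<in> sets borel"
  using assms bounded_section_projection_borel[of H d] unfolding bounded_borel_rel_def by blast

lemma bounded_borel_rel_exists:
  assumes "bounded_borel_rel d H" "S \<in> sets borel"
  shows "{x. \<exists>y. (x, y) \<in> H \<and> (x, y) \<in> S} \<in> sets borel"
proof -
  have "H \<inter> S \<in> sets borel" using assms unfolding bounded_borel_rel_def by auto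
  then have "Domain (H \<inter> S) \<in> sets borel"
    using bounded_borel_rel_Domain bounded_borel_rel_subset[OF assms(1)] by (metis Int_lower1)
  moreover have "Domain (H \<inter> S) = {x. \<exists>y. (x, y) \<in> H \<and> (x, y) \<in> S}" by auto
  ultimately show ?thesis by simp
qed

lemma borel_Collect_continuous:
  assumes "continuous_on UNIV f" "A \<in> sets borel"
  shows "{x. f x \<in> A} \<in> sets borel"
  using measurable_sets_borel[OF borel_measurable_continuous_onI[OF assms(1)] assms(2)]
  by (simp add: vimage_def)

lemma bounded_borel_rel_exists_in:
  assumes "bounded_borel_rel d H" "A \<in> sets borel"
  shows "{x. \<exists>y\<in>A. (x, y) \<in> H} \<in> sets borel"
proof -
  have "{x. \<exists>y. (x, y) \<in> H \<and> (x, y) \<in> {p. snd p \<in> A}} \<in> sets borel"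
    using assms by (intro bounded_borel_rel_exists borel_Collect_continuous continuous_intros)
  moreover have "{x. \<exists>y. (x, y) \<in> H \<and> (x, y) \<in> {p. snd p \<in> A}} = {x. \<exists>y\<in>A. (x, y) \<in> H}" by auto
  ultimately show ?thesis by simp
qed

lemma Id_borel: "(Id :: ('a::{second_countable_topology, t2_space} \<times> 'a) set) \<in> sets borel"
proof -
  have "closed {p :: 'a \<times> 'a. fst p = snd p}" by (intro closed_Collect_eq continuous_intros)
  moreover have "{p :: 'a \<times> 'a. fst p = snd p} = Id" by auto
  ultimately show ?thesis by auto
qed

lemma bounded_borel_rel_reflcl:
  assumes "bounded_borel_rel d H"
  shows "bounded_borel_rel (Suc d) (H\<^sup>=)"
proof -
  have "H \<union> Id \<in> sets borel" using assms Id_borel unfolding bounded_borel_rel_def by auto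
  moreover have "(H \<union> Id) `` {x} = insert x (H `` {x})" for x by auto
  ultimately show ?thesis using assms unfolding bounded_borel_rel_def
    by (auto intro: order_trans[OF card_insert_le_m1] simp: card_insert_if le_SucI)
qed

lemma bounded_borel_rel_relcomp:
  fixes H G :: "('a::polish_space \<times> 'a) set"
  assumes H: "bounded_borel_rel d H" and G: "bounded_borel_rel d' G"
  shows "bounded_borel_rel (d * d') (H O G)"
proof -
  \<comment> \<open>The midpoint is the last component, and the midpoints over a given pair lie
    among the \<open>H\<close>-successors of its first entry. Hence the projection theorem gives
    Borelness of the composition.\<close>
  define K where "K = {p :: ('a \<times> 'a) \<times> 'a. (fst (fst p), snd p) \<in> H} \<inter> {p. (snd p, snd (fst p)) \<in> G}"
  have HG: "H \<in> sets borel" "G \<in> sets borel" using H G unfolding bounded_borel_rel_def by blast+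
  have "{p :: ('a \<times> 'a) \<times> 'a. (fst (fst p), snd p) \<in> H} \<in> sets borel"
    by (intro borel_Collect_continuous[OF _ HG(1)] continuous_intros)
  moreover have "{p :: ('a \<times> 'a) \<times> 'a. (snd p, snd (fst p)) \<in> G} \<in> sets borel"
    by (intro borel_Collect_continuous[OF _ HG(2)] continuous_intros)
  ultimately have K: "K \<in> sets borel" unfolding K_def by (rule sets.Int)
  have "finite (K `` {q}) \<and> card (K `` {q}) \<le> d" for q
  proof -
    have "K `` {q} \<subseteq> H `` {fst q}" unfolding K_def by auto
    then show ?thesis using H unfolding bounded_borel_rel_def by (meson card_mono finite_subset order_trans)
  qed
  with K have "Domain K \<in> sets borel" by (rule bounded_section_projection_borel)
  moreover have "Domain K = H O G" unfolding K_def by auto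
  moreover have "finite ((H O G) `` {x}) \<and> card ((H O G) `` {x}) \<le> d * d'" for x
  proof -
    have eq: "(H O G) `` {x} = (\<Union>y\<in>H `` {x}. G `` {y})" by auto
    have fin: "finite (H `` {x})" "card (H `` {x}) \<le> d" "\<And>y. finite (G `` {y})" "\<And>y. card (G `` {y}) \<le> d'"
      using H G unfolding bounded_borel_rel_def by auto
    have "card (\<Union>y\<in>H `` {x}. G `` {y}) \<le> (\<Sum>y\<in>H `` {x}. card (G `` {y}))" using fin by (intro card_UN_le)
    also have "\<dots> \<le> card (H `` {x}) * d'" using fin sum_bounded_above[of "H `` {x}" "\<lambda>y. card (G `` {y})" d'] by simp
    also have "\<dots> \<le> d * d'" using fin by simp
    finally show ?thesis unfolding eq using fin by auto
  qed
  ultimately show ?thesis unfolding bounded_borel_rel_def by simp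
qed

lemma bounded_borel_rel_relpow:
  assumes "bounded_borel_rel d H"
  shows "bounded_borel_rel (d ^ n) (H ^^ n)"
proof (induction n)
  case 0
  have "(Id :: ('a \<times> 'a) set) `` {x} = {x}" for x by auto
  then show ?case using Id_borel unfolding bounded_borel_rel_def by auto
next
  case (Suc n)
  then show ?case using bounded_borel_rel_relcomp[OF Suc assms] by (simp add: mult.commute)
qed

lemma maximal_independent_borel:
  fixes H :: "('a::polish_space \<times> 'a) set"
  assumes H: "bounded_borel_rel d H" and sym: "sym H" and A: "A \<in> sets borel"
  shows "\<exists>I\<in>sets borel. I \<subseteq> A \<and> (\<forall>x\<in>I. \<forall>y\<in>I. (x, y) \<in> H \<longrightarrow> x = y) \<and> (\<forall>x\<in>A - I. \<exists>y\<in>I. (x, y) \<in> H)"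
proof -
  \<comment> \<open>The sets \<open>P n\<close> below exclude points related to a member of
    \<open>U n\<close>; a loop would make a point exclude itself.\<close>
  define G where "G = H - Id"
  have "G \<in> sets borel" unfolding G_def using H Id_borel unfolding bounded_borel_rel_def by blast
  then have G: "bounded_borel_rel d G" by (intro bounded_borel_rel_subset[OF H]) (simp_all add: G_def)
  have symG: "(y, x) \<in> G" if "(x, y) \<in> G" for x y using that sym unfolding G_def by (auto dest: symD)
  obtain \<B> :: "'a set set" where \<B>: "countable \<B>" "topological_basis \<B>" using ex_countable_basis by metis
  have "\<B> \<noteq> {}" using \<B>(2) by (metis UNIV_I empty_iff open_UNIV topological_basisE)
  then obtain U :: "nat \<Rightarrow> 'a set" where U: "\<B> = range U" using \<B>(1) uncountable_def by metis
  have Uo: "open (U n)" for n using \<B>(2) U topological_basis_open by blast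
  \<comment> \<open>\<open>P n\<close> is independent, and the sets \<open>P n\<close> cover \<open>A\<close> since sections of \<open>G\<close> are closed.\<close>
  define P where "P n = A \<inter> U n - {x. \<exists>y\<in>U n. (x, y) \<in> G}" for n
  have P: "P n \<in> sets borel" for n unfolding P_def using A Uo bounded_borel_rel_exists_in[OF G] by auto
  \<comment> \<open>Greedy selection: round \<open>n\<close> adds the points of \<open>P n\<close>
    without a neighbour selected so far. A point of \<open>P n\<close> that is left out therefore
    has a neighbour in \<open>S n\<close>, which gives maximality.\<close>
  define S where "S = rec_nat {} (\<lambda>n X. X \<union> (P n - {x. \<exists>y\<in>X. (x, y) \<in> G}))"
  have S0: "S 0 = {}" and SS: "S (Suc n) = S n \<union> (P n - {x. \<exists>y\<in>S n. (x, y) \<in> G})" for n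
    unfolding S_def by simp_all
  have Sb: "S n \<in> sets borel" for n
    by (induction n) (use P bounded_borel_rel_exists_in[OF G] in \<open>auto simp: S0 SS\<close>)
  have SA: "S n \<subseteq> A" for n by (induction n) (auto simp: S0 SS P_def)
  have Sind: "(x, y) \<notin> G" if "x \<in> S n" "y \<in> S n" for x y n
    using that
  proof (induction n)
    case 0
    then show ?case by (simp add: S0)
  next
    case (Suc n)
    then show ?case using symG unfolding SS P_def by blast
  qed
  have mono: "S m \<subseteq> S n" if "m \<le> n" for m n
    by (rule lift_Suc_mono_le[OF _ that]) (auto simp: SS)
  define I where "I = (\<Union>n. S n)"
  have I1: "I \<in> sets borel" unfolding I_def using Sb by auto
  have I2: "I \<subseteq> A" unfolding I_def using SA by blast
  have I3: "x = y" if xy: "x \<in> I" "y \<in> I" "(x, y) \<in> H" for x y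
  proof -
    obtain m n where "x \<in> S m" "y \<in> S n" using xy unfolding I_def by blast
    then have "x \<in> S (max m n)" "y \<in> S (max m n)" using mono[of m "max m n"] mono[of n "max m n"] by auto
    then have "(x, y) \<notin> G" using Sind by blast
    then show ?thesis using xy unfolding G_def by auto
  qed
  have I4: "\<exists>y\<in>I. (x, y) \<in> H" if x: "x \<in> A - I" for x
  proof -
    have fin: "finite (G `` {x})" using G unfolding bounded_borel_rel_def by blast
    then have "open (- (G `` {x}))" by (simp add: finite_imp_closed open_Compl)
    moreover have "x \<in> - (G `` {x})" unfolding G_def by auto
    ultimately obtain n where n: "x \<in> U n" "U n \<subseteq> - (G `` {x})"
      using topological_basisE[OF \<B>(2)] unfolding U by (metis rangeE)
    then have "x \<in> P n" unfolding P_def using x by auto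
    moreover have "x \<notin> S (Suc n)" using x unfolding I_def by blast
    ultimately obtain y where "y \<in> S n" "(x, y) \<in> G" unfolding SS by blast
    then show ?thesis unfolding I_def G_def by blast
  qed
  show ?thesis
  proof (intro bexI[of _ I] conjI ballI impI)
    show "x = y" if "x \<in> I" "y \<in> I" "(x, y) \<in> H" for x y using that by (rule I3)
    show "\<exists>y\<in>I. (x, y) \<in> H" if "x \<in> A - I" for x using that by (rule I4)
  qed (fact I1 I2)+
qed

text \<open>Maximal independent sets are split off one after another. A vertex left over after
  \<open>d + 1\<close> rounds would be related to a vertex in each of \<open>d + 1\<close> disjoint
  classes, which exceeds the bound \<open>d\<close>.\<close>

theorem borel_vertex_coloring:
  fixes H :: "('a::polish_space \<times> 'a) set"
  assumes H: "bounded_borel_rel d H" and sym: "sym H"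
  obtains \<kappa> :: "'a \<Rightarrow> nat" where "\<And>n. {x. \<kappa> x = n} \<in> sets borel" "\<And>x. \<kappa> x \<le> d"
    "\<And>x y. (x, y) \<in> H \<Longrightarrow> \<kappa> x = \<kappa> y \<Longrightarrow> x = y"
proof -
  obtain I where I: "\<And>A. A \<in> sets borel \<Longrightarrow> I A \<in> sets borel"
    "\<And>A. A \<in> sets borel \<Longrightarrow> I A \<subseteq> A"
    "\<And>A x y. A \<in> sets borel \<Longrightarrow> x \<in> I A \<Longrightarrow> y \<in> I A \<Longrightarrow> (x, y) \<in> H \<Longrightarrow> x = y"
    "\<And>A x. A \<in> sets borel \<Longrightarrow> x \<in> A - I A \<Longrightarrow> \<exists>y\<in>I A. (x, y) \<in> H"
  proof -
    have "\<forall>A\<in>sets borel. \<exists>I. I \<in> sets borel \<and> I \<subseteq> A \<and> (\<forall>x\<in>I. \<forall>y\<in>I. (x, y) \<in> H \<longrightarrow> x = y)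
        \<and> (\<forall>x\<in>A - I. \<exists>y\<in>I. (x, y) \<in> H)"
      using maximal_independent_borel[OF H sym] unfolding Bex_def by simp
    from bchoice[OF this] obtain I where I: "\<forall>A\<in>sets borel. I A \<in> sets borel \<and> I A \<subseteq> A
        \<and> (\<forall>x\<in>I A. \<forall>y\<in>I A. (x, y) \<in> H \<longrightarrow> x = y) \<and> (\<forall>x\<in>A - I A. \<exists>y\<in>I A. (x, y) \<in> H)" ..
    show thesis by (rule that[of I]) (simp_all add: I)
  qed
  define R where "R = rec_nat UNIV (\<lambda>n X. X - I X)"
  have R0: "R 0 = UNIV" and RS: "R (Suc n) = R n - I (R n)" for n unfolding R_def by simp_all
  have R: "R n \<in> sets borel" for n by (induction n) (use I(1) in \<open>auto simp: R0 RS\<close>)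
  have mono: "R n \<subseteq> R m" if "m \<le> n" for m n
    by (rule lift_Suc_antimono_le[OF _ that]) (auto simp: RS)
  define J where "J n = I (R n)" for n
  have disj: "m = n" if "x \<in> J m" "x \<in> J n" for x m n
  proof -
    have *: "\<not> m < n" if "x \<in> J m" "x \<in> J n" for m n
    proof
      assume "m < n"
      then have "R n \<subseteq> R m - I (R m)" using mono[of "Suc m" n] unfolding RS by simp
      then show False using that I(2)[OF R, of n] unfolding J_def by blast
    qed
    show ?thesis using *[of m n] *[of n m] that by linarith
  qed
  have cover: "\<exists>n\<le>d. x \<in> J n" for x
  proof (rule ccontr)
    assume none: "\<not> ?thesis"
    have "x \<in> R n" if "n \<le> Suc d" for n
      using that by (induction n) (use none in \<open>auto simp: R0 RS J_def\<close>)
    then have "\<exists>y\<in>J n. (x, y) \<in> H" if "n \<le> d" for n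
      using I(4)[OF R, of x n] none that unfolding J_def by auto
    then obtain y where y: "\<And>n. n \<le> d \<Longrightarrow> y n \<in> J n \<and> (x, y n) \<in> H" by metis
    have "inj_on y {..d}" using y disj unfolding inj_on_def by (metis atMost_iff)
    then have "card (y ` {..d}) = Suc d" by (simp add: card_image)
    moreover have "y ` {..d} \<subseteq> H `` {x}" using y by auto
    ultimately have "Suc d \<le> card (H `` {x})" using H unfolding bounded_borel_rel_def by (metis card_mono)
    then show False using H unfolding bounded_borel_rel_def by (metis not_less_eq_eq)
  qed
  then obtain \<kappa> where \<kappa>: "\<And>x. \<kappa> x \<le> d \<and> x \<in> J (\<kappa> x)" by metis
  have eq: "{x. \<kappa> x = n} = (if n \<le> d then J n else {})" for n using \<kappa> disj by auto
  show thesis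
  proof (rule that[of \<kappa>])
    show "{x. \<kappa> x = n} \<in> sets borel" for n unfolding eq J_def using I(1)[OF R] by auto
    show "\<kappa> x \<le> d" for x using \<kappa> by blast
    show "x = y" if "(x, y) \<in> H" "\<kappa> x = \<kappa> y" for x y
    proof (rule I(3)[OF R _ _ that(1)])
      show "x \<in> I (R (\<kappa> x))" using \<kappa>[of x] unfolding J_def by simp
      show "y \<in> I (R (\<kappa> x))" using \<kappa>[of y] that(2) unfolding J_def by simp
    qed
  qed
qed

section \<open>Alternating walks\<close>

text \<open>For two matchings this is the alternating path from \<open>y\<close>, with
  \<open>f\<close> first. A fixed point stands for a missing edge; a walk that runs into one turns
  around and retraces its path.\<close>

primrec zigzag :: "('a \<Rightarrow> 'a) \<Rightarrow> ('a \<Rightarrow> 'a) \<Rightarrow> nat \<Rightarrow> 'a \<Rightarrow> 'a" where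
  "zigzag f g 0 y = y"
| "zigzag f g (Suc t) y = (if even t then f else g) (zigzag f g t y)"

declare zigzag.simps(2) [simp del]

text \<open>Each involution moves along the walk, forwards or backwards according to parity. At
  \<open>i = 0\<close> the truncated \<open>i - 1\<close> is again 0, which is correct because
  \<open>g\<close> fixes the source.\<close>

lemma zigzag_step:
  assumes "\<And>x. f (f x) = x" "\<And>x. g (g x) = x" "g y = y"
  shows "f (zigzag f g i y) = (if even i then zigzag f g (Suc i) y else zigzag f g (i - 1) y)"
    and "g (zigzag f g i y) = (if odd i then zigzag f g (Suc i) y else zigzag f g (i - 1) y)"
  by (cases i; use assms in \<open>simp add: zigzag.simps(2)\<close>)+

text \<open>Once the walk halts at position \<open>u\<close>, the positions up to \<open>u\<close>
  are closed under both involutions, so nothing new is ever reached.\<close>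

lemma zigzag_stuck:
  assumes inv: "\<And>x. f (f x) = x" "\<And>x. g (g x) = x" "g y = y"
    and stuck: "zigzag f g (Suc u) y = zigzag f g u y"
  shows "zigzag f g t y \<in> (\<lambda>i. zigzag f g i y) ` {..u}"
proof (induction t)
  case 0
  then show ?case by force
next
  case (Suc t)
  from Suc obtain i where "zigzag f g t y = zigzag f g i y" "i \<in> {..u}" by (rule imageE)
  then have i: "i \<le> u" "zigzag f g t y = zigzag f g i y" by simp_all
  define j where "j = (if even t = even i then Suc i else i - 1)"
  have "zigzag f g (Suc t) y = (if even t then f else g) (zigzag f g i y)"
    using i(2) by (simp add: zigzag.simps(2))
  also have "\<dots> = zigzag f g j y"
    using zigzag_step(1)[OF inv, of i] zigzag_step(2)[OF inv, of i] unfolding j_def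
    by (cases "even t"; cases "even i") simp_all
  also have "\<dots> \<in> (\<lambda>i. zigzag f g i y) ` {..u}"
  proof (cases "j = Suc u")
    case True
    then show ?thesis using stuck by (intro image_eqI[of _ _ u]) simp_all
  next
    case False
    then show ?thesis using i(1) unfolding j_def by (intro imageI) (auto split: if_splits)
  qed
  finally show ?case .
qed

text \<open>Both walks are traced back; equal parity means that they retrace the same edges, and neither
  can be continued backwards beyond its source, where \<^term>\<open>g\<close> has a fixed point.\<close>

lemma zigzag_unique_source:
  assumes inv: "\<And>x. f (f x) = x" "\<And>x. g (g x) = x" and y: "g y = y" and y': "g y' = y'"
    and "zigzag f g i y = zigzag f g j y'" "i \<le> j" "even (j - i)"
    and "\<And>u. u < j \<Longrightarrow> zigzag f g (Suc u) y' \<noteq> zigzag f g u y'"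
  shows "i = j \<and> y = y'"
  using assms(5-)
proof (induction i arbitrary: j)
  case 0
  show ?case
  proof (cases j)
    case 0
    then show ?thesis using "0.prems"(1) by simp
  next
    case (Suc l)
    then have "odd l" using "0.prems"(3) by simp
    \<comment> \<open>\<open>g\<close> leads from position \<open>j\<close> back to
      \<open>l\<close>, but it fixes the point at \<open>j\<close>, which is the source
      \<open>y\<close>. So the walk from \<open>y'\<close> would halt at step
      \<open>l\<close>.\<close>
    have "zigzag f g l y' = g (zigzag f g j y')" using zigzag_step(2)[OF inv y', of j] Suc \<open>odd l\<close> by simp
    also have "\<dots> = zigzag f g (Suc l) y'" using "0.prems"(1) y Suc by simp
    finally show ?thesis using "0.prems"(4)[of l] Suc by simp
  qed
next
  case (Suc i)
  obtain l where l: "j = Suc l" using Suc.prems(2) by (cases j) auto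
  have "even (l + i)" using Suc.prems(2,3) unfolding l by simp
  then have par: "even i = even l" by (simp add: even_add)
  have "zigzag f g i y = (if even i then f else g) (zigzag f g (Suc i) y)"
    using inv by (simp add: zigzag.simps(2))
  also have "\<dots> = (if even l then f else g) (zigzag f g (Suc l) y')" using Suc.prems(1) unfolding l par by simp
  also have "\<dots> = zigzag f g l y'" using inv by (simp add: zigzag.simps(2))
  finally have "i = l \<and> y = y'" using Suc.prems unfolding l by (intro Suc.IH) auto
  then show ?case using l by simp
qed

text \<open>At two positions of odd distance, the step forward from the first and the step back from
  the second use the same involution. The coincidence thus moves inwards from both sides until it
  concerns two consecutive positions.\<close>

lemma zigzag_meet:
  assumes inv: "\<And>x. f (f x) = x" "\<And>x. g (g x) = x"
    and "zigzag f g i y = zigzag f g (Suc (i + 2 * m)) y"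
  shows "\<exists>u\<le>i + m. zigzag f g (Suc u) y = zigzag f g u y"
  using assms(3)
proof (induction m arbitrary: i)
  case 0
  then have "zigzag f g (Suc i) y = zigzag f g i y" by simp
  then show ?case by (intro exI[of _ i]) simp
next
  case (Suc m)
  have "zigzag f g (Suc i) y = (if even i then f else g) (zigzag f g (Suc (i + 2 * Suc m)) y)"
    using Suc.prems by (simp add: zigzag.simps(2))
  also have "\<dots> = zigzag f g (i + 2 * Suc m) y" using inv by (simp add: zigzag.simps(2))
  finally have "zigzag f g (Suc i) y = zigzag f g (Suc (Suc i + 2 * m)) y" by simp
  from Suc.IH[OF this] show ?case by auto
qed

text \<open>A repetition at even distance contradicts uniqueness of the source; one at odd distance
  forces a halt in between.\<close>

lemma zigzag_inj_on:
  assumes inv: "\<And>x. f (f x) = x" "\<And>x. g (g x) = x" and y: "g y = y"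
    and moving: "\<And>u. u < t \<Longrightarrow> zigzag f g (Suc u) y \<noteq> zigzag f g u y"
  shows "inj_on (\<lambda>i. zigzag f g i y) {..t}"
proof (rule linorder_inj_onI)
  fix i j assume ij: "i < j" "i \<in> {..t}" "j \<in> {..t}"
  show "zigzag f g i y \<noteq> zigzag f g j y"
  proof
    assume eq: "zigzag f g i y = zigzag f g j y"
    show False
    proof (cases "even (j - i)")
      case True
      have "i = j \<and> y = y"
        by (rule zigzag_unique_source[OF inv y y eq]) (use True ij moving in auto)
      then show False using ij by simp
    next
      case False
      then obtain m where m: "j - i = Suc (2 * m)" by (metis oddE Suc_eq_plus1)
      then have j: "j = Suc (i + 2 * m)" using ij by simp
      with eq have "zigzag f g i y = zigzag f g (Suc (i + 2 * m)) y" by simp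
      from zigzag_meet[OF inv this] obtain u where "u \<le> i + m" "zigzag f g (Suc u) y = zigzag f g u y" by blast
      moreover from this have "u < t" using j ij by simp
      ultimately show False using moving by blast
    qed
  qed
qed auto

text \<open>Consider the first arrival \<open>T\<close> at \<open>x\<close>. The last step cannot
  use \<open>f\<close>, which fixes \<open>x\<close>, so \<open>T\<close> is even; the
  \<open>T + 1\<close> distinct vertices up to \<open>x\<close> and the edge back to
  \<open>y\<close> then form an odd cycle.\<close>

lemma zigzag_avoids:
  assumes inv: "\<And>x. f (f x) = x" "\<And>x. g (g x) = x" and y: "g y = y" and x: "f x = x"
    and edges: "\<And>v. f v \<noteq> v \<Longrightarrow> (v, f v) \<in> E" "\<And>v. g v \<noteq> v \<Longrightarrow> (v, g v) \<in> E"
    and E: "(x, y) \<in> E" "x \<noteq> y" and cyc: "\<not> has_odd_cycle E"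
  shows "zigzag f g t y \<noteq> x"
proof
  assume "zigzag f g t y = x"
  define T where "T = (LEAST t. zigzag f g t y = x)"
  have T: "zigzag f g T y = x" unfolding T_def by (rule LeastI) fact
  have least: "zigzag f g u y \<noteq> x" if "u < T" for u
    using that not_less_Least unfolding T_def by blast
  have moving: "zigzag f g (Suc u) y \<noteq> zigzag f g u y" if "u < T" for u
  proof
    assume "zigzag f g (Suc u) y = zigzag f g u y"
    from zigzag_stuck[OF inv y this, of T] T obtain i where "i \<le> u" "zigzag f g i y = x" by auto
    then show False using least[of i] that by simp
  qed
  have "even T"
  proof (rule ccontr)
    assume "odd T"
    then obtain s where s: "T = Suc s" "even s" by (metis even_Suc oddE Suc_eq_plus1 even_mult_iff even_numeral)
    then have "zigzag f g s y = f x" using zigzag_step(1)[OF inv y, of T] T by simp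
    then show False using x least[of s] s by simp
  qed
  moreover have "T \<noteq> 0" using T E(2) by (intro notI) simp
  ultimately have n: "odd (Suc T)" "3 \<le> Suc T" by (auto elim!: evenE)
  have step: "(zigzag f g i y, zigzag f g (Suc i) y) \<in> E" if "i < T" for i
    using moving[OF that] edges[of "zigzag f g i y"] by (auto simp: zigzag.simps(2) split: if_splits)
  have "(zigzag f g i y, zigzag f g (Suc i mod Suc T) y) \<in> E" if "i < Suc T" for i
  proof (cases "i = T")
    case True
    then show ?thesis using T E(1) by simp
  next
    case False
    then show ?thesis using step[of i] that by simp
  qed
  moreover have "inj_on (\<lambda>i. zigzag f g i y) {..<Suc T}"
    using zigzag_inj_on[OF inv y, of T] moving by (simp add: lessThan_Suc_atMost)
  ultimately have "has_odd_cycle E"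
    unfolding has_odd_cycle_def using n by (intro exI[of _ "Suc T"] exI[of _ "\<lambda>i. zigzag f g i y"]) blast
  then show False using cyc by simp
qed

lemma zigzag_relpow:
  assumes "\<And>v. (v, f v) \<in> R" "\<And>v. (v, g v) \<in> R"
  shows "(y, zigzag f g t y) \<in> R ^^ t"
  using assms by (induction t) (auto simp: zigzag.simps(2))

text \<open>The image of a set under an involution is its preimage, so each step preserves Borelness
  by measurability.\<close>

lemma zigzag_image_borel:
  fixes f g :: "'a::topological_space \<Rightarrow> 'a"
  assumes inv: "\<And>x. f (f x) = x" "\<And>x. g (g x) = x"
    and meas: "f \<in> borel_measurable borel" "g \<in> borel_measurable borel" and A: "A \<in> sets borel"
  shows "zigzag f g t ` A \<in> sets borel"
proof (induction t)
  case 0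
  have "zigzag f g 0 ` A = A" by auto
  then show ?case using A by simp
next
  case (Suc t)
  have im: "h ` B = h -` B" if "\<And>x. h (h x) = x" for h :: "'a \<Rightarrow> 'a" and B
  proof (rule set_eqI)
    show "x \<in> h ` B \<longleftrightarrow> x \<in> h -` B" for x using that by (metis image_iff vimage_eq)
  qed
  have "zigzag f g (Suc t) ` A = (if even t then f else g) ` zigzag f g t ` A"
    by (auto simp: image_image zigzag.simps(2))
  also have "\<dots> = (if even t then f else g) -` (zigzag f g t ` A)" using im[of f] im[of g] inv by simp
  also have "\<dots> \<in> sets borel" using meas Suc by (intro measurable_sets_borel) auto
  finally show ?case .
qed

lemma zigzag_measurable:
  fixes f g :: "'a::topological_space \<Rightarrow> 'a"
  assumes "f \<in> borel_measurable borel" "g \<in> borel_measurable borel"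
  shows "zigzag f g t \<in> borel_measurable borel"
proof (induction t)
  case (Suc t)
  then have "(if even t then f else g) \<circ> zigzag f g t \<in> borel_measurable borel"
    using assms by (intro measurable_comp[OF Suc]) auto
  moreover have "(if even t then f else g) \<circ> zigzag f g t = zigzag f g (Suc t)" by (auto simp: fun_eq_iff zigzag.simps(2))
  ultimately show ?case by (simp only:)
qed (simp add: id_def[symmetric])

section \<open>Partial edge colorings\<close>

text \<open>A partial proper edge coloring is encoded by one involution per color: \<^term>\<open>p c x\<close> is the
  neighbour joined to \<^term>\<open>x\<close> by an edge of color \<^term>\<open>c\<close>, and \<^term>\<open>x\<close> itself if there is none.\<close>

definition matching_coloring :: "('a::polish_space \<times> 'a) set \<Rightarrow> nat \<Rightarrow> (nat \<Rightarrow> 'a \<Rightarrow> 'a) \<Rightarrow> bool" where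
  "matching_coloring E k p \<longleftrightarrow>
     (\<forall>c. p c \<in> borel_measurable borel \<and> (\<forall>x. p c (p c x) = x \<and> (p c x = x \<or> (x, p c x) \<in> E)))
     \<and> (\<forall>c d x. c \<noteq> d \<longrightarrow> p c x = p d x \<longrightarrow> p c x = x) \<and> (\<forall>c\<ge>k. p c = id)"

text \<open>The potential of the improvement argument: the integral of the number of colors present
  at a vertex. For a probability measure it is at most \<open>k\<close>.\<close>

definition covered :: "'a::polish_space measure \<Rightarrow> nat \<Rightarrow> (nat \<Rightarrow> 'a \<Rightarrow> 'a) \<Rightarrow> real" where
  "covered \<mu> k p = (\<Sum>c<k. measure \<mu> {x. p c x \<noteq> x})"

lemma matching_coloringD:
  assumes "matching_coloring E k p"
  shows "p c \<in> borel_measurable borel" "p c (p c x) = x" "p c x = x \<or> (x, p c x) \<in> E"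
    "c \<noteq> d \<Longrightarrow> p c x = p d x \<Longrightarrow> p c x = x" "k \<le> c \<Longrightarrow> p c x = x"
  using assms unfolding matching_coloring_def by (auto simp del: not_le)

lemma equalizer_borel:
  fixes f g :: "'b::topological_space \<Rightarrow> 'a::{second_countable_topology, t2_space}"
  assumes "f \<in> borel_measurable borel" "g \<in> borel_measurable borel"
  shows "{x. f x = g x} \<in> sets borel"
proof -
  have "(\<lambda>x. (f x, g x)) \<in> borel_measurable borel" using assms by (intro borel_measurable_Pair)
  then have "(\<lambda>x. (f x, g x)) -` Id \<in> sets borel" by (rule measurable_sets_borel[OF _ Id_borel])
  moreover have "(\<lambda>x. (f x, g x)) -` Id = {x. f x = g x}" by auto
  ultimately show ?thesis by simp
qed

lemma moved_borel:
  fixes f :: "'a::{second_countable_topology, t2_space} \<Rightarrow> 'a"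
  assumes "f \<in> borel_measurable borel"
  shows "{x. f x \<noteq> x} \<in> sets borel"
proof -
  have "- {x. f x = x} \<in> sets borel" by (intro borel_comp equalizer_borel assms) simp
  then show ?thesis by (simp add: Collect_neg_eq)
qed

section \<open>Removing, exchanging and adding colors, and the effect on the potential\<close>

lemma matching_coloring_remove:
  assumes p: "matching_coloring E k p" and Q: "Q \<in> sets borel" "\<And>v. v \<in> Q \<Longrightarrow> p a v \<in> Q" and a: "a < k"
  shows "matching_coloring E k (p(a := \<lambda>v. if v \<in> Q then v else p a v))"
proof -
  note pD = matching_coloringD[OF p]
  have Q': "p a v \<notin> Q" if "v \<notin> Q" for v using Q(2)[of "p a v"] that pD(2) by auto
  have "(\<lambda>v. if v \<in> Q then v else p a v) \<in> borel_measurable borel"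
    using Q(1) pD(1) by (intro measurable_If_set) auto
  then show ?thesis unfolding matching_coloring_def
    using pD Q' a by (auto simp: fun_eq_iff)
qed

lemma covered_remove:
  assumes p: "matching_coloring E k p" and Q: "Q \<in> sets borel" and a: "a < k"
    and \<mu>: "finite_measure \<mu>" "sets \<mu> = sets borel"
  shows "covered \<mu> k p \<le> covered \<mu> k (p(a := \<lambda>v. if v \<in> Q then v else p a v)) + measure \<mu> Q"
proof -
  note pD = matching_coloringD[OF p]
  let ?q = "p(a := \<lambda>v. if v \<in> Q then v else p a v)"
  have split: "covered \<mu> k r = measure \<mu> {x. r a x \<noteq> x} + (\<Sum>c\<in>{..<k} - {a}. measure \<mu> {x. r c x \<noteq> x})" for r
    unfolding covered_def using a by (intro sum.remove) auto
  have "{x. p a x \<noteq> x} \<in> sets \<mu>" using moved_borel[OF pD(1)] \<mu>(2) by simp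
  then have "measure \<mu> {x. p a x \<noteq> x} \<le> measure \<mu> (({x. p a x \<noteq> x} - Q) \<union> Q)"
    using Q \<mu> by (intro finite_measure.finite_measure_mono) auto
  also have "\<dots> \<le> measure \<mu> ({x. p a x \<noteq> x} - Q) + measure \<mu> Q"
    using Q \<mu> \<open>{x. p a x \<noteq> x} \<in> sets \<mu>\<close> by (intro measure_Un_le) auto
  also have "{x. p a x \<noteq> x} - Q = {x. ?q a x \<noteq> x}" by auto
  finally show ?thesis unfolding split[of p] split[of ?q] by simp
qed

text \<open>A Kempe exchange. Invariance under both involutions makes \<open>F\<close> a union of
  whole \<open>a\<close>-\<open>b\<close> components, so both ends of an edge are recolored
  together.\<close>

lemma matching_coloring_swap:
  assumes p: "matching_coloring E k p" and F: "F \<in> sets borel"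
    and Fa: "\<And>v. v \<in> F \<Longrightarrow> p a v \<in> F" and Fb: "\<And>v. v \<in> F \<Longrightarrow> p b v \<in> F" and ab: "a < k" "b < k"
  shows "matching_coloring E k (\<lambda>c v. if v \<in> F then p (Transposition.transpose a b c) v else p c v)"
proof -
  note pD = matching_coloringD[OF p]
  let ?q = "\<lambda>c v. if v \<in> F then p (Transposition.transpose a b c) v else p c v"
  have F': "p c v \<in> F \<longleftrightarrow> v \<in> F" if "c = a \<or> c = b" for c v
    using Fa[of v] Fb[of v] Fa[of "p a v"] Fb[of "p b v"] that pD(2)[of a v] pD(2)[of b v] by metis
  have t: "Transposition.transpose a b c = c" if "\<not> (c = a \<or> c = b)" for c using that by (simp add: Transposition.transpose_def)
  have ti: "Transposition.transpose a b c \<noteq> Transposition.transpose a b d" if "c \<noteq> d" for c d using that by (auto simp add: transpose_eq_iff)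
  have "?q c (?q c x) = x" for c x
  proof (cases "c = a \<or> c = b")
    case True
    then have "Transposition.transpose a b c = a \<or> Transposition.transpose a b c = b" by (auto simp: Transposition.transpose_def)
    then show ?thesis using F'[of "Transposition.transpose a b c" x] F'[OF True, of x]
        pD(2)[of c x] pD(2)[of "Transposition.transpose a b c" x] by simp
  next
    case False
    then show ?thesis using t[of c] pD(2)[of c x] by simp
  qed
  moreover have "?q c \<in> borel_measurable borel" for c
    using F pD(1) by (intro measurable_If_set) auto
  moreover have "?q c x = x \<or> (x, ?q c x) \<in> E" for c x
    using pD(3)[of c x] pD(3)[of "Transposition.transpose a b c" x] by simp
  moreover have "?q c x = x" if "c \<noteq> d" "?q c x = ?q d x" for c d x
    using pD(4)[OF ti[OF that(1)], of x] pD(4)[OF that(1), of x] that(2) by (auto split: if_splits)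
  moreover have "?q c = id" if "k \<le> c" for c
    using t[of c] pD(5)[OF that] ab that by (auto simp: fun_eq_iff)
  ultimately show ?thesis unfolding matching_coloring_def by blast
qed

text \<open>At each vertex the exchange at most permutes the colors present, so their number stays
  the same pointwise and the equality holds for every finite measure.\<close>

lemma covered_swap:
  assumes p: "matching_coloring E k p" and F: "F \<in> sets borel" and ab: "a < k" "b < k"
    and \<mu>: "finite_measure \<mu>" "sets \<mu> = sets borel"
  shows "covered \<mu> k (\<lambda>c v. if v \<in> F then p (Transposition.transpose a b c) v else p c v) = covered \<mu> k p"
proof -
  note pD = matching_coloringD[OF p]
  define m where "m c = measure \<mu> ({x. p c x \<noteq> x} \<inter> F)" for c
  define n where "n c = measure \<mu> ({x. p c x \<noteq> x} - F)" for c
  have M: "{x. p c x \<noteq> x} \<in> sets \<mu>" for c using moved_borel[OF pD(1)] \<mu>(2) by simp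
  have union: "measure \<mu> (({x. p c x \<noteq> x} \<inter> F) \<union> ({x. p d x \<noteq> x} - F)) = m c + n d" for c d
    unfolding m_def n_def using M F \<mu> by (intro finite_measure.finite_measure_Union) auto
  have "covered \<mu> k p = (\<Sum>c<k. m c + n c)"
    unfolding covered_def union[symmetric] by (intro sum.cong arg_cong[of _ _ "measure \<mu>"]) auto
  moreover have "covered \<mu> k (\<lambda>c v. if v \<in> F then p (Transposition.transpose a b c) v else p c v)
      = (\<Sum>c<k. m (Transposition.transpose a b c) + n c)"
    unfolding covered_def union[symmetric] by (intro sum.cong arg_cong[of _ _ "measure \<mu>"]) auto
  moreover have "(\<Sum>c<k. m (Transposition.transpose a b c)) = (\<Sum>c<k. m c)"
    using ab sum.permute[of "Transposition.transpose a b" "{..<k}" m]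
    by (simp add: permutes_swap_id comp_def)
  ultimately show ?thesis by (simp add: sum.distrib)
qed

lemma matching_coloring_add:
  assumes p: "matching_coloring E k p" and E: "bounded_borel_rel d E" and M: "M \<in> sets borel" "M \<subseteq> E" "sym M"
    and unique: "\<And>v w w'. (v, w) \<in> M \<Longrightarrow> (v, w') \<in> M \<Longrightarrow> w = w'"
    and missing: "\<And>v w. (v, w) \<in> M \<Longrightarrow> p a v = v"
    and uncol: "\<And>v w c. (v, w) \<in> M \<Longrightarrow> p c v \<noteq> w" and a: "a < k"
    and \<mu>: "finite_measure \<mu>" "sets \<mu> = sets borel"
  shows "\<exists>q. matching_coloring E k q \<and> covered \<mu> k q = covered \<mu> k p + measure \<mu> (Domain M)"
proof -
  note pD = matching_coloringD[OF p]
  have BM: "bounded_borel_rel d M" using bounded_borel_rel_subset[OF E M(2,1)] .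
  have DM: "Domain M \<in> sets borel" using bounded_borel_rel_Domain[OF BM] .
  have "\<exists>f. (\<forall>v w. (v, w) \<in> M \<longrightarrow> f v = w) \<and> (\<forall>v. v \<notin> Domain M \<longrightarrow> f v = p a v)"
    by (rule exI[of _ "\<lambda>v. if v \<in> Domain M then (THE w. (v, w) \<in> M) else p a v"])
      (use unique in \<open>auto intro!: the_equality\<close>)
  \<comment> \<open>\<open>f\<close> is the enlarged matching of color \<open>a\<close>: the partner
    under \<open>M\<close> where there is one, and \<open>p a\<close> elsewhere. The two parts do
    not interfere because \<open>a\<close> is missing at the vertices of \<open>M\<close>.\<close>
  then obtain f where f: "\<And>v w. (v, w) \<in> M \<Longrightarrow> f v = w" "\<And>v. v \<notin> Domain M \<Longrightarrow> f v = p a v" by blast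
  have pa: "p a v \<notin> Domain M" if "v \<notin> Domain M" for v
    using that missing pD(2) by (metis Domain.cases)
  have fm: "f \<in> borel_measurable borel"
  proof (rule borel_measurableI)
    fix U :: "'a set" assume U: "open U"
    \<comment> \<open>Inside \<open>Domain M\<close> the preimage is a projection of
      \<open>M\<close> with bounded sections; outside it is a preimage under
      \<open>p a\<close>.\<close>
    have "f -` U \<inter> space borel = {v. \<exists>w\<in>U. (v, w) \<in> M} \<union> (p a -` U - Domain M)"
    proof (rule set_eqI)
      fix v
      show "v \<in> f -` U \<inter> space borel \<longleftrightarrow> v \<in> {v. \<exists>w\<in>U. (v, w) \<in> M} \<union> (p a -` U - Domain M)"
      proof (cases "v \<in> Domain M")
        case True
        then obtain w where w: "(v, w) \<in> M" by blast
        then have "(\<exists>w'\<in>U. (v, w') \<in> M) \<longleftrightarrow> w \<in> U" using unique by blast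
        then show ?thesis using f(1)[OF w] True by simp
      next
        case False
        then show ?thesis using f(2)[OF False] by auto
      qed
    qed
    also have "\<dots> \<in> sets borel"
      using bounded_borel_rel_exists_in[OF BM, of U] U DM measurable_sets_borel[OF pD(1), of U a] by auto
    finally show "f -` U \<inter> space borel \<in> sets borel" .
  qed
  have ff: "f (f v) = v" for v
  proof (cases "v \<in> Domain M")
    case True
    then obtain w where w: "(v, w) \<in> M" by blast
    then have "(w, v) \<in> M" using M(3) by (auto dest: symD)
    then show ?thesis using f(1) w by metis
  next
    case False
    then show ?thesis using f(2) pa pD(2) by metis
  qed
  have fE: "f v = v \<or> (v, f v) \<in> E" for v
  proof (cases "v \<in> Domain M")
    case True
    then obtain w where w: "(v, w) \<in> M" by blast
    then show ?thesis using f(1)[OF w] M(2) by auto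
  next
    case False
    then show ?thesis using f(2)[OF False] pD(3) by metis
  qed
  have fc: "f v = v \<and> p c v = v" if "c \<noteq> a" "f v = p c v" for c v
  proof (cases "v \<in> Domain M")
    case True
    then obtain w where w: "(v, w) \<in> M" by blast
    then show ?thesis using f(1)[OF w] uncol[OF w, of c] that by simp
  next
    case False
    then show ?thesis using f(2)[OF False] pD(4)[OF that(1), of v] that by simp
  qed
  let ?q = "p(a := f)"
  have q: "matching_coloring E k ?q" unfolding matching_coloring_def
  proof (intro conjI allI impI)
    show "?q c x = x" if "c \<noteq> d" "?q c x = ?q d x" for c d x
      using fc[of c x] fc[of d x] pD(4)[OF that(1), of x] that by (auto split: if_splits)
    show "?q c = id" if "k \<le> c" for c using pD(5)[OF that] a that by (auto simp: fun_eq_iff)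
  qed (use fm ff fE pD in auto)
  have split: "covered \<mu> k r = measure \<mu> {x. r a x \<noteq> x} + (\<Sum>c\<in>{..<k} - {a}. measure \<mu> {x. r c x \<noteq> x})" for r
    unfolding covered_def using a by (intro sum.remove) auto
  have moved: "{x. f x \<noteq> x} = {x. p a x \<noteq> x} \<union> Domain M"
  proof (rule set_eqI)
    fix v show "v \<in> {x. f x \<noteq> x} \<longleftrightarrow> v \<in> {x. p a x \<noteq> x} \<union> Domain M"
    proof (cases "v \<in> Domain M")
      case True
      then obtain w where w: "(v, w) \<in> M" by blast
      then show ?thesis using f(1)[OF w] uncol[OF w, of a] missing[OF w] by auto
    next
      case False
      then show ?thesis using f(2)[OF False] by auto
    qed
  qed
  have "measure \<mu> {x. f x \<noteq> x} = measure \<mu> {x. p a x \<noteq> x} + measure \<mu> (Domain M)"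
    unfolding moved using \<mu> DM moved_borel[OF pD(1)] missing
    by (intro finite_measure.finite_measure_Union) auto
  then have "covered \<mu> k ?q = covered \<mu> k p + measure \<mu> (Domain M)"
    unfolding split[of p] split[of ?q] by simp
  with q show ?thesis by blast
qed

section \<open>Augmentation\<close>

lemma relpow_reflcl_mono:
  assumes "m \<le> n"
  shows "(R\<^sup>=) ^^ m \<subseteq> (R\<^sup>=) ^^ n"
  using assms
proof (rule lift_Suc_mono_le[rotated])
  show "(R\<^sup>=) ^^ n \<subseteq> (R\<^sup>=) ^^ Suc n" for n by (auto intro: relpow_Suc_I)
qed

lemma sym_relpow:
  assumes "sym R"
  shows "sym (R ^^ n)"
proof (rule symI)
  show "(y, x) \<in> R ^^ n" if "(x, y) \<in> R ^^ n" for x y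
    using that
  proof (induction n arbitrary: y)
    case (Suc n)
    from Suc.prems obtain u where "(x, u) \<in> R ^^ n" "(u, y) \<in> R" by (rule relpow_Suc_E)
    then show ?case using Suc.IH assms by (intro relpow_Suc_I2) (auto dest: symD)
  qed simp
qed

text \<open>One round of simultaneous Kempe exchanges. In a pair \<open>(y, x)\<close> of
  \<open>M\<close>, the walk starts at \<open>y\<close>, where \<open>b\<close> is missing, and is
  to free \<open>a\<close> at \<open>y\<close>, while \<open>a\<close> is already missing at
  \<open>x\<close>. The separation of starting points keeps each \<open>x\<close> off the walks of
  other pairs and prevents two pairs from sharing an \<open>x\<close>; the latter takes distance 2,
  which \<open>2 * s + 2\<close> allows even for \<open>s = 0\<close>. The price is paid at the two
  ends of each cut edge, whose starting points form \<open>S\<close>.\<close>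

lemma augment:
  assumes p: "matching_coloring E k p" and E: "bounded_borel_rel d E" and symE: "sym E" and irr: "\<And>x. (x, x) \<notin> E"
    and cyc: "\<not> has_odd_cycle E" and ab: "a < k" "b < k"
    and M: "M \<in> sets borel" "M \<subseteq> E" and unique: "\<And>y x x'. (y, x) \<in> M \<Longrightarrow> (y, x') \<in> M \<Longrightarrow> x = x'"
    and uncol: "\<And>y x c. (y, x) \<in> M \<Longrightarrow> c < k \<Longrightarrow> p c y \<noteq> x"
    and missing: "\<And>y x. (y, x) \<in> M \<Longrightarrow> p a x = x \<and> p b y = y"
    and far: "\<And>y y'. y \<in> Domain M \<Longrightarrow> y' \<in> Domain M \<Longrightarrow> (y, y') \<in> (E\<^sup>=) ^^ (2 * s + 2) \<Longrightarrow> y = y'"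
    and \<mu>: "finite_measure \<mu>" "sets \<mu> = sets borel"
  defines "z \<equiv> zigzag (p a) (p b)"
  defines "S \<equiv> {y \<in> Domain M. \<forall>u\<le>2 * s. z (Suc u) y \<noteq> z u y}"
  shows "\<exists>q. matching_coloring E k q \<and>
    covered \<mu> k p + measure \<mu> (Domain M) \<le> covered \<mu> k q + measure \<mu> (z (2 * s) ` S) + measure \<mu> (z (2 * s + 1) ` S)"
proof -
  note pD = matching_coloringD[OF p]
  note inv = pD(2)[of a] pD(2)[of b]
  have zm: "z t \<in> borel_measurable borel" for t unfolding z_def by (intro zigzag_measurable pD)
  have zi: "A \<in> sets borel \<Longrightarrow> z t ` A \<in> sets borel" for t A unfolding z_def
    by (intro zigzag_image_borel inv pD)
  have DM: "Domain M \<in> sets borel" using bounded_borel_rel_Domain[OF bounded_borel_rel_subset[OF E M(2,1)]] .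
  have "S = Domain M - (\<Union>u\<in>{..2 * s}. {y. z (Suc u) y = z u y})" unfolding S_def by auto
  also have "\<dots> \<in> sets borel" using equalizer_borel[OF zm zm] DM by (intro sets.Diff sets.finite_UN) auto
  finally have SB: "S \<in> sets borel" .
  have Sb: "p b y = y" if "y \<in> Domain M" for y using missing that by blast
  have step_a: "p a (z t y) = (if even t then z (Suc t) y else z (t - 1) y)"
    and step_b: "p b (z t y) = (if odd t then z (Suc t) y else z (t - 1) y)" if "y \<in> Domain M" for t y
    unfolding z_def using zigzag_step[OF inv Sb[OF that]] by simp_all
  have dist: "(y, z t y) \<in> (E\<^sup>=) ^^ t" for t y
    unfolding z_def by (rule zigzag_relpow) (use pD(3) in \<open>metis UnCI pair_in_Id_conv\<close>)+
  have far': "y = y'" if "y \<in> Domain M" "y' \<in> Domain M" "(y, y') \<in> (E\<^sup>=) ^^ n" "n \<le> 2 * s + 2" for y y' n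
    using far[OF that(1,2)] relpow_reflcl_mono[OF that(4), of E] that(3) by blast
  have two: "(y, y') \<in> (E\<^sup>=) ^^ 2" if "(y, x) \<in> E" "(y', x) \<in> E" for x y y'
  proof -
    have "(x, y') \<in> E" using that(2) symE by (auto dest: symD)
    then have "(y, y') \<in> (E\<^sup>=) O (E\<^sup>=)" using that(1) by blast
    then show ?thesis by (simp add: numeral_2_eq_2)
  qed

  \<comment> \<open>Cut the walks that are still moving after \<open>2 * s\<close> steps.\<close>
  define Q where "Q = z (2 * s) ` S \<union> z (2 * s + 1) ` S"
  define p1 where "p1 = p(a := \<lambda>v. if v \<in> Q then v else p a v)"
  have QB: "Q \<in> sets borel" unfolding Q_def using zi SB by blast
  have SM: "S \<subseteq> Domain M" unfolding S_def by blast
  have Qinv: "p a v \<in> Q" if "v \<in> Q" for v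
  proof -
    obtain y where y: "y \<in> S" "v = z (2 * s) y \<or> v = z (2 * s + 1) y" using \<open>v \<in> Q\<close> unfolding Q_def by blast
    then have "p a v = z (2 * s + 1) y \<or> p a v = z (2 * s) y"
      using step_a[of y "2 * s"] step_a[of y "2 * s + 1"] SM by auto
    then show ?thesis unfolding Q_def using y(1) by blast
  qed
  have p1: "matching_coloring E k p1" unfolding p1_def by (rule matching_coloring_remove[OF p QB Qinv ab(1)])
  have cov1: "covered \<mu> k p \<le> covered \<mu> k p1 + measure \<mu> Q"
    unfolding p1_def by (rule covered_remove[OF p QB ab(1) \<mu>])
  have "measure \<mu> Q \<le> measure \<mu> (z (2 * s) ` S) + measure \<mu> (z (2 * s + 1) ` S)"
    unfolding Q_def by (rule measure_Un_le) (use zi SB \<mu>(2) in auto)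
  note cov1 = cov1 this
  have p1p: "p1 c v = v \<or> p1 c v = p c v" for c v unfolding p1_def by simp

  \<comment> \<open>\<open>F\<close> collects the walks up to position \<open>2 * s\<close>. The
    next edge would have color \<open>a\<close>; it has been removed unless the walk halted before,
    so \<open>F\<close> is invariant under both involutions of \<open>p1\<close>.\<close>
  define F where "F = (\<Union>t\<in>{..2 * s}. z t ` Domain M)"
  have FB: "F \<in> sets borel" unfolding F_def using zi DM by (intro sets.finite_UN) auto
  have FI: "z t y \<in> F" if "t \<le> 2 * s" "y \<in> Domain M" for t y unfolding F_def using that by blast
  have Fa: "p1 a v \<in> F" if "v \<in> F" for v
  proof -
    obtain t y where t: "t \<le> 2 * s" "y \<in> Domain M" "v = z t y" using \<open>v \<in> F\<close> unfolding F_def by auto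
    show ?thesis
    proof (cases "p1 a v = v")
      case True
      then show ?thesis using that by simp
    next
      case False
      then have pa: "p1 a v = p a v" and "v \<notin> Q" unfolding p1_def by auto
      show ?thesis
      proof (cases "t = 2 * s")
        case True
        then have "y \<notin> S" using \<open>v \<notin> Q\<close> t(3) unfolding Q_def by blast
        then obtain u where u: "u \<le> 2 * s" "z (Suc u) y = z u y" using t(2) unfolding S_def by blast
        have "z (2 * s + 1) y \<in> (\<lambda>i. z i y) ` {..u}"
          using zigzag_stuck[OF inv Sb[OF t(2)], of u] u(2) unfolding z_def by simp
        then have "z (2 * s + 1) y \<in> F" using FI[OF _ t(2)] u(1) by auto
        then show ?thesis using pa step_a[OF t(2), of t] t(3) True by simp
      next
        case False
        then show ?thesis using pa step_a[OF t(2), of t] t FI[OF _ t(2)] by auto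
      qed
    qed
  qed
  have Fb: "p1 b v \<in> F" if "v \<in> F" for v
  proof -
    obtain t y where t: "t \<le> 2 * s" "y \<in> Domain M" "v = z t y" using \<open>v \<in> F\<close> unfolding F_def by auto
    have "p b v \<in> F"
    proof (cases "odd t")
      case True
      then have "Suc t \<le> 2 * s" using t(1) by (metis even_mult_iff even_numeral le_neq_implies_less Suc_leI)
      then show ?thesis using step_b[OF t(2), of t] t(3) True FI[OF _ t(2)] by simp
    next
      case False
      then show ?thesis using step_b[OF t(2), of t] t FI[OF _ t(2), of "t - 1"] by simp
    qed
    then show ?thesis using p1p[of b v] that by auto
  qed
  define p2 where "p2 = (\<lambda>c v. if v \<in> F then p1 (Transposition.transpose a b c) v else p1 c v)"
  have p2: "matching_coloring E k p2" unfolding p2_def by (rule matching_coloring_swap[OF p1 FB Fa Fb ab])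
  have cov2: "covered \<mu> k p2 = covered \<mu> k p1" unfolding p2_def by (rule covered_swap[OF p1 FB ab \<mu>])
  have p2p: "p2 c v = v \<or> (\<exists>d. p2 c v = p d v)" for c v
    unfolding p2_def using p1p[of c v] p1p[of "Transposition.transpose a b c" v] by auto

  \<comment> \<open>If \<open>x\<close> were on the walk from \<open>y'\<close>, then
    \<open>y'\<close> and \<open>y\<close> would be at most \<open>2 * s + 1\<close> steps apart and
    hence equal. The walk from \<open>y\<close> itself avoids \<open>x\<close> since there is no odd
    cycle.\<close>
  have xF: "x \<notin> F" if yx: "(y, x) \<in> M" for y x
  proof
    assume "x \<in> F"
    then obtain t y' where t: "t \<le> 2 * s" "y' \<in> Domain M" "x = z t y'" unfolding F_def by auto
    have "(x, y) \<in> E" using yx M(2) symE by (auto dest: symD)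
    then have "(y', y) \<in> (E\<^sup>=) ^^ Suc t" using dist[of y' t] t(3) by (auto intro: relpow_Suc_I)
    then have "y' = y" using far'[of y' y "Suc t"] t yx by auto
    moreover have "z t y \<noteq> x" unfolding z_def
    proof (rule zigzag_avoids[OF inv])
      show "p b y = y" "p a x = x" using missing[OF yx] by simp_all
      show "(v, p a v) \<in> E" if "p a v \<noteq> v" for v using that pD(3)[of a v] by simp
      show "(v, p b v) \<in> E" if "p b v \<noteq> v" for v using that pD(3)[of b v] by simp
      show "(x, y) \<in> E" "x \<noteq> y" using \<open>(x, y) \<in> E\<close> irr by auto
    qed (fact cyc)
    ultimately show False using t(3) by simp
  qed
  define N where "N = M \<union> M\<inverse>"
  have "M\<inverse> = {q. (snd q, fst q) \<in> M}" by auto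
  also have "\<dots> \<in> sets borel" by (intro borel_Collect_continuous[OF _ M(1)] continuous_intros)
  finally have NB: "N \<in> sets borel" unfolding N_def using M(1) by blast
  have NE: "N \<subseteq> E" unfolding N_def using M(2) symE by (auto dest: symD)
  have symN: "sym N" unfolding N_def by (auto intro: symI)
  have noboth: "x \<notin> Domain M" if yx: "(y, x) \<in> M" for y x
  proof
    assume "x \<in> Domain M"
    moreover have "(y, x) \<in> (E\<^sup>=) ^^ 1" using yx M(2) by auto
    ultimately have "y = x" using yx by (intro far'[of y x 1]) auto
    then show False using yx M(2) irr by blast
  qed
  have same: "y = y'" if "(y, x) \<in> M" "(y', x) \<in> M" for x y y'
    by (rule far'[OF _ _ two[of y x y']]) (use that M(2) in auto)
  have Nunique: "w = w'" if "(v, w) \<in> N" "(v, w') \<in> N" for v w w'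
    using that noboth unique same unfolding N_def by blast
  have uncol': "p c v \<noteq> w" if vw: "(v, w) \<in> N" for v w c
  proof
    assume eq: "p c v = w"
    have "v \<noteq> w" using vw NE irr by blast
    have "c < k"
    proof (rule ccontr)
      assume "\<not> c < k"
      then have "p c v = v" by (intro pD(5)) simp
      then show False using \<open>v \<noteq> w\<close> eq by simp
    qed
    moreover have "p c w = v" using pD(2)[of c v] eq by simp
    ultimately show False using uncol vw eq unfolding N_def by blast
  qed
  have p2_uncol: "p2 c v \<noteq> w" if vw: "(v, w) \<in> N" for v w c
  proof -
    have "v \<noteq> w" using vw NE irr by blast
    then show ?thesis using p2p[of c v] uncol'[OF vw] by metis
  qed
  \<comment> \<open>At the start \<open>y\<close>, which lies in \<open>F\<close>, color
    \<open>a\<close> has taken the place of the missing \<open>b\<close>; the other end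
    \<open>x\<close> lies outside \<open>F\<close> and still misses \<open>a\<close>.\<close>
  have p2_missing: "p2 a v = v" if vw: "(v, w) \<in> N" for v w
  proof -
    consider "(v, w) \<in> M" | "(w, v) \<in> M" using vw unfolding N_def by blast
    then show ?thesis
    proof cases
      case 1
      then have "v \<in> Domain M" by blast
      then have "v \<in> F" using FI[of 0 v] unfolding z_def by simp
      then show ?thesis using p1p[of b v] missing[OF 1] unfolding p2_def by auto
    next
      case 2
      then show ?thesis using xF[OF 2] p1p[of a v] missing[OF 2] unfolding p2_def by auto
    qed
  qed
  have "\<exists>q. matching_coloring E k q \<and> covered \<mu> k q = covered \<mu> k p2 + measure \<mu> (Domain N)"
  proof (rule matching_coloring_add[OF p2 E NB NE symN _ _ _ ab(1) \<mu>])
    show "w = w'" if "(v, w) \<in> N" "(v, w') \<in> N" for v w w' using that by (rule Nunique)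
    show "p2 a v = v" if "(v, w) \<in> N" for v w using that by (rule p2_missing)
    show "p2 c v \<noteq> w" if "(v, w) \<in> N" for v w c using that by (rule p2_uncol)
  qed
  then obtain q where q: "matching_coloring E k q" "covered \<mu> k q = covered \<mu> k p2 + measure \<mu> (Domain N)" by blast
  have "measure \<mu> (Domain M) \<le> measure \<mu> (Domain N)"
    using bounded_borel_rel_Domain[OF bounded_borel_rel_subset[OF E NE NB]] \<mu>
    by (intro finite_measure.finite_measure_mono) (auto simp: N_def)
  then show ?thesis using q cov1 cov2 by (intro exI[of _ q]) linarith
qed

section \<open>From single rounds to colorings complete up to small measure\<close>

definition incomplete :: "('a \<times> 'a) set \<Rightarrow> nat \<Rightarrow> (nat \<Rightarrow> 'a \<Rightarrow> 'a) \<Rightarrow> 'a set" where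
  "incomplete E k p = {y. \<exists>x. (y, x) \<in> E \<and> (\<forall>c<k. p c y \<noteq> x)}"

lemma color_class_borel:
  assumes "matching_coloring E k p"
  shows "{q. p c (fst q) = snd q} \<in> sets borel"
proof (rule equalizer_borel)
  have "fst \<in> borel_measurable (borel :: ('a \<times> 'a) measure)" "snd \<in> borel_measurable (borel :: ('a \<times> 'a) measure)"
    by (intro borel_measurable_continuous_onI continuous_intros)+
  then show "(\<lambda>q. p c (fst q)) \<in> borel_measurable (borel :: ('a \<times> 'a) measure)"
    "snd \<in> borel_measurable (borel :: ('a \<times> 'a) measure)"
    using measurable_compose[OF _ matching_coloringD(1)[OF assms]] by blast+
qed

lemma incomplete_borel:
  assumes p: "matching_coloring E k p" and E: "bounded_borel_rel d E"
  shows "incomplete E k p \<in> sets borel"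
proof -
  have "(\<Union>c<k. {q. p c (fst q) = snd q}) \<in> sets borel" using color_class_borel[OF p] by (intro sets.finite_UN) auto
  then have "E - (\<Union>c<k. {q. p c (fst q) = snd q}) \<in> sets borel" using E unfolding bounded_borel_rel_def by blast
  then have "Domain (E - (\<Union>c<k. {q. p c (fst q) = snd q})) \<in> sets borel"
    by (intro bounded_borel_rel_Domain[OF bounded_borel_rel_subset[OF E]]) auto
  moreover have "Domain (E - (\<Union>c<k. {q. p c (fst q) = snd q})) = incomplete E k p"
    unfolding incomplete_def set_eq_iff Domain_iff by (simp add: Ball_def)
  ultimately show ?thesis by simp
qed

text \<open>If all \<open>k\<close> colors were present at \<open>v\<close>, they would lead to
  \<open>k\<close> distinct neighbours other than \<open>w\<close>, one too many for the degree
  bound.\<close>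

lemma missing_color:
  assumes p: "matching_coloring E k p" and E: "bounded_borel_rel k E" and vw: "(v, w) \<in> E" "\<And>c. c < k \<Longrightarrow> p c v \<noteq> w"
  shows "\<exists>c<k. p c v = v"
proof (rule ccontr)
  assume none: "\<not> ?thesis"
  note pD = matching_coloringD[OF p]
  have fin: "finite (E `` {v})" "card (E `` {v}) \<le> k" using E unfolding bounded_borel_rel_def by blast+
  have "inj_on (\<lambda>c. p c v) {..<k}"
    using pD(4)[of _ _ v] none unfolding inj_on_def by (metis lessThan_iff)
  then have "card ((\<lambda>c. p c v) ` {..<k}) = k" by (simp add: card_image)
  moreover have "(\<lambda>c. p c v) ` {..<k} \<subseteq> E `` {v} - {w}" using none vw(2) pD(3)[of _ v] by auto
  ultimately have "k \<le> card (E `` {v} - {w})" using fin by (metis card_mono finite_Diff)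
  moreover have "card (E `` {v} - {w}) < card (E `` {v})" using fin vw by (intro psubset_card_mono) auto
  ultimately show False using fin by simp
qed

text \<open>The value \<open>r\<close> selects one end of the cut edge. For fixed \<open>r\<close>
  these ends are distinct for different cut positions and starting points, which makes the sets of
  cuts disjoint.\<close>

lemma zigzag_source_unique_same_parity:
  assumes inv: "\<And>x. f (f x) = x" "\<And>x. g (g x) = x" and y: "g y = y" and y': "g y' = y'"
    and eq: "zigzag f g (2 * s + r) y = zigzag f g (2 * s' + r) y'" and r: "r \<le> 1"
    and moving: "\<And>u. u \<le> 2 * s \<Longrightarrow> zigzag f g (Suc u) y \<noteq> zigzag f g u y"
      "\<And>u. u \<le> 2 * s' \<Longrightarrow> zigzag f g (Suc u) y' \<noteq> zigzag f g u y'"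
  shows "s = s' \<and> y = y'"
proof (cases "s \<le> s'")
  case True
  have "2 * s + r = 2 * s' + r \<and> y = y'"
    by (rule zigzag_unique_source[OF inv y y' eq]) (use True r moving(2) in auto)
  then show ?thesis by simp
next
  case False
  have "2 * s' + r = 2 * s + r \<and> y' = y"
    by (rule zigzag_unique_source[OF inv y' y eq[symmetric]]) (use False r moving(1) in auto)
  then show ?thesis by auto
qed

lemma sum_measure_disjoint_le_1:
  assumes "prob_space \<mu>" "finite I" "disjoint_family_on A I" "\<And>i. i \<in> I \<Longrightarrow> A i \<in> sets \<mu>"
  shows "(\<Sum>i\<in>I. measure \<mu> (A i)) \<le> 1"
proof -
  interpret prob_space \<mu> by fact
  have "(\<Sum>i\<in>I. measure \<mu> (A i)) = measure \<mu> (\<Union>i\<in>I. A i)"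
    by (rule finite_measure_finite_Union[symmetric]) (use assms in auto)
  then show ?thesis by simp
qed


text \<open>The gain \<delta> is fixed before the coloring \<open>p\<close>, which makes iteration
  terminate. Pigeonhole picks a large set of starting points of one type; averaging over their
  \<kappa>-classes and the cut positions then finds a round that gains more than its cuts
  cost.\<close>

theorem improvement:
  assumes E: "bounded_borel_rel k E" and symE: "sym E" and irr: "\<And>x. (x, x) \<notin> E" and cyc: "\<not> has_odd_cycle E"
    and \<mu>: "prob_space \<mu>" "sets \<mu> = sets borel" and \<epsilon>: "\<epsilon> > 0"
  obtains \<delta> where "\<delta> > 0"
    "\<And>p. matching_coloring E k p \<Longrightarrow> \<epsilon> \<le> measure \<mu> (incomplete E k p) \<Longrightarrow>
      \<exists>q. matching_coloring E k q \<and> covered \<mu> k p + \<delta> \<le> covered \<mu> k q"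
proof -
  interpret prob_space \<mu> by fact
  have fm: "finite_measure \<mu>" by unfold_locales
  \<comment> \<open>A coloring along \<open>E O E\<close> gives different values to the neighbours
    of a vertex. Once the value at \<open>x\<close> is prescribed, \<open>y\<close> therefore
    determines \<open>x\<close>.\<close>
  have "sym (E O E)" using symE by (auto intro!: symI dest: symD)
  then obtain \<kappa>' :: "'a \<Rightarrow> nat" where \<kappa>': "\<And>n. {x. \<kappa>' x = n} \<in> sets borel" "\<And>x. \<kappa>' x \<le> k * k"
    "\<And>x y. (x, y) \<in> E O E \<Longrightarrow> \<kappa>' x = \<kappa>' y \<Longrightarrow> x = y"
    using borel_vertex_coloring[OF bounded_borel_rel_relcomp[OF E E]] by metis
  \<comment> \<open>A type consists of the value of \<kappa>' at \<open>x\<close>, a color missing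
    at \<open>x\<close> and a color missing at \<open>y\<close>.\<close>
  define I where "I = {..k * k} \<times> {..<k} \<times> {..<k}"
  define \<epsilon>' where "\<epsilon>' = \<epsilon> / (real (card I) + 1)"
  have \<epsilon>': "\<epsilon>' > 0" unfolding \<epsilon>'_def using \<epsilon> by simp
  \<comment> \<open>For each of the two ends of a cut edge, all cuts together have measure at most
    1. The choice of \<open>L\<close> makes half of \<open>real L * \<epsilon>'\<close> exceed this
    total of 2.\<close>
  obtain L where L: "4 / \<epsilon>' < real L" using reals_Archimedean2 by blast
  have L0: "L > 0" using L \<epsilon>' by (cases L) (auto simp: field_simps)
  \<comment> \<open>The radius \<open>2 * L\<close> covers the distance \<open>2 * s + 2\<close>
    required for every \<open>s < L\<close>. \<open>D\<close> bounds the number of vertices within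
    this radius, so that \<open>Suc D\<close> classes suffice.\<close>
  define H where "H = (E\<^sup>=) ^^ (2 * L)"
  define D where "D = Suc k ^ (2 * L)"
  have "sym (E\<^sup>=)" using symE by (auto intro!: symI dest: symD)
  then have "sym H" unfolding H_def by (rule sym_relpow)
  then obtain \<kappa> :: "'a \<Rightarrow> nat" where \<kappa>: "\<And>n. {x. \<kappa> x = n} \<in> sets borel" "\<And>x. \<kappa> x \<le> D"
    "\<And>x y. (x, y) \<in> H \<Longrightarrow> \<kappa> x = \<kappa> y \<Longrightarrow> x = y"
    using borel_vertex_coloring[OF bounded_borel_rel_relpow[OF bounded_borel_rel_reflcl[OF E], of "2 * L"]]
    unfolding H_def D_def by metis
  \<comment> \<open>Summed over the \<open>Suc D * L\<close> pairs of class and cut position,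
    \<delta> uses up half of \<open>real L * \<epsilon>'\<close>.\<close>
  define \<delta> where "\<delta> = \<epsilon>' / (2 * real (Suc D))"
  have \<delta>: "\<delta> > 0" unfolding \<delta>_def using \<epsilon>' by simp
  have "\<exists>q. matching_coloring E k q \<and> covered \<mu> k p + \<delta> \<le> covered \<mu> k q"
    if p: "matching_coloring E k p" and large: "\<epsilon> \<le> measure \<mu> (incomplete E k p)" for p
  proof -
    note pD = matching_coloringD[OF p]
    have fixB: "{x. p c x = x} \<in> sets borel" for c by (rule equalizer_borel[OF pD(1)]) simp
    define N where "N = (\<lambda>(i, a, b). (E \<inter> {q. snd q \<in> {x. \<kappa>' x = i}} \<inter> {q. snd q \<in> {x. p a x = x}}
        \<inter> {q. fst q \<in> {x. p b x = x}}) - (\<Union>c<k. {q. p c (fst q) = snd q}))"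
    have NB: "N t \<in> sets borel" for t
    proof -
      obtain i a b where t: "t = (i, a, b)" by (cases t)
      have "(\<Union>c<k. {q. p c (fst q) = snd q}) \<in> sets borel" using color_class_borel[OF p] by (intro sets.finite_UN) auto
      moreover have "{q. snd q \<in> {x. \<kappa>' x = i}} \<in> sets (borel :: ('a \<times> 'a) measure)"
        by (intro borel_Collect_continuous[OF _ \<kappa>'(1)] continuous_intros)
      moreover have "{q. snd q \<in> {x. p a x = x}} \<in> sets (borel :: ('a \<times> 'a) measure)"
        by (intro borel_Collect_continuous[OF _ fixB] continuous_intros)
      moreover have "{q. fst q \<in> {x. p b x = x}} \<in> sets (borel :: ('a \<times> 'a) measure)"
        by (intro borel_Collect_continuous[OF _ fixB] continuous_intros)
      ultimately show ?thesis using E unfolding N_def t bounded_borel_rel_def prod.case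
        by (intro sets.Diff sets.Int) simp_all
    qed
    have NE: "N t \<subseteq> E" for t unfolding N_def by (cases t) auto
    have NDom: "Domain (N t) \<in> sets \<mu>" for t
      using bounded_borel_rel_Domain[OF bounded_borel_rel_subset[OF E NE NB]] \<mu>(2) by simp
    have Nmem: "(y, x) \<in> N (i, a, b) \<longleftrightarrow>
        (y, x) \<in> E \<and> \<kappa>' x = i \<and> p a x = x \<and> p b y = y \<and> (\<forall>c<k. p c y \<noteq> x)" for y x i a b
      unfolding N_def by auto
    \<comment> \<open>An uncolored edge leaves a color missing at each of its ends, so every
      incomplete vertex occurs in some type.\<close>
    have "incomplete E k p \<subseteq> (\<Union>t\<in>I. Domain (N t))"
    proof
      fix y assume "y \<in> incomplete E k p"
      then obtain x where x: "(y, x) \<in> E" "\<And>c. c < k \<Longrightarrow> p c y \<noteq> x" unfolding incomplete_def by blast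
      obtain b where b: "b < k" "p b y = y" using missing_color[OF p E x] by blast
      have "(x, y) \<in> E" using x(1) symE by (auto dest: symD)
      moreover have "p c x \<noteq> y" if "c < k" for c using x(2)[OF that] pD(2)[of c x] by auto
      ultimately obtain a where a: "a < k" "p a x = x" using missing_color[OF p E] by blast
      have "(y, x) \<in> N (\<kappa>' x, a, b)" unfolding Nmem using x a b by blast
      moreover have "(\<kappa>' x, a, b) \<in> I" unfolding I_def using \<kappa>'(2) a b by simp
      ultimately show "y \<in> (\<Union>t\<in>I. Domain (N t))" by blast
    qed
    then have "measure \<mu> (incomplete E k p) \<le> measure \<mu> (\<Union>t\<in>I. Domain (N t))"
      using NDom by (intro finite_measure_mono) (auto simp: I_def)
    also have "\<dots> \<le> (\<Sum>t\<in>I. measure \<mu> (Domain (N t)))"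
      using NDom by (intro finite_measure_subadditive_finite) (auto simp: I_def)
    finally have sum_ge: "\<epsilon> \<le> (\<Sum>t\<in>I. measure \<mu> (Domain (N t)))" using large by simp
    have "\<exists>t\<in>I. \<epsilon>' \<le> measure \<mu> (Domain (N t))"
    proof (rule ccontr)
      assume "\<not> ?thesis"
      then have "(\<Sum>t\<in>I. measure \<mu> (Domain (N t))) \<le> of_nat (card I) * \<epsilon>'"
        by (intro sum_bounded_above) (auto simp: not_le)
      also have "\<dots> < (real (card I) + 1) * \<epsilon>'" using \<epsilon>' by (simp add: algebra_simps)
      also have "\<dots> = \<epsilon>" unfolding \<epsilon>'_def by (simp add: field_simps)
      finally show False using sum_ge by simp
    qed
    then obtain i a b where iab: "(i, a, b) \<in> I" "\<epsilon>' \<le> measure \<mu> (Domain (N (i, a, b)))" by force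
    then have ab: "a < k" "b < k" unfolding I_def by auto
    define T where "T = Domain (N (i, a, b))"
    have TB: "T \<in> sets borel" unfolding T_def using NDom \<mu>(2) by simp
    define z where "z = zigzag (p a) (p b)"
    have zi: "A \<in> sets borel \<Longrightarrow> z t ` A \<in> sets borel" for t A unfolding z_def
      by (intro zigzag_image_borel pD)
    have zm: "z t \<in> borel_measurable borel" for t unfolding z_def by (intro zigzag_measurable pD)
    define S where "S = (\<lambda>(j, s). {y \<in> T. \<kappa> y = j \<and> (\<forall>u\<le>2 * s. z (Suc u) y \<noteq> z u y)})"
    have SB: "S q \<in> sets borel" for q
    proof -
      obtain j s where q: "q = (j, s)" by force
      have "S q = (T \<inter> {x. \<kappa> x = j}) - (\<Union>u\<in>{..2 * s}. {y. z (Suc u) y = z u y})" unfolding S_def q by auto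
      also have "\<dots> \<in> sets borel" using equalizer_borel[OF zm zm] TB \<kappa>(1) by (intro sets.Diff sets.Int sets.finite_UN) auto
      finally show ?thesis .
    qed
    define X where "X = {..D} \<times> {..<L}"
    \<comment> \<open>A point common to two of these sets would have the same cut position and the
      same starting point, and the starting point determines its class.\<close>
    have total: "(\<Sum>q\<in>X. measure \<mu> (z (2 * snd q + r) ` S q)) \<le> 1" if r: "r \<le> 1" for r
    proof (rule sum_measure_disjoint_le_1[OF \<mu>(1)])
      show "disjoint_family_on (\<lambda>q. z (2 * snd q + r) ` S q) X"
        unfolding disjoint_family_on_def
      proof (intro ballI impI)
        fix q q' :: "nat \<times> nat" assume ne: "q \<noteq> q'"
        show "z (2 * snd q + r) ` S q \<inter> z (2 * snd q' + r) ` S q' = {}"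
        proof (rule ccontr)
          assume "\<not> ?thesis"
          then obtain y y' where y: "y \<in> S q" "y' \<in> S q'" "z (2 * snd q + r) y = z (2 * snd q' + r) y'" by blast
          have S': "p b w = w \<and> \<kappa> w = fst t \<and> (\<forall>u\<le>2 * snd t. z (Suc u) w \<noteq> z u w)" if "w \<in> S t" for w t
            using that Nmem unfolding S_def T_def by (cases t) auto
          have "snd q = snd q' \<and> y = y'"
            by (rule zigzag_source_unique_same_parity[OF pD(2) pD(2) _ _ y(3)[unfolded z_def] r])
              (use S'[OF y(1)] S'[OF y(2)] in \<open>auto simp: z_def\<close>)
          then show False using ne S'[OF y(1)] S'[OF y(2)] by (metis prod_eqI)
        qed
      qed
    qed (use zi SB \<mu>(2) in \<open>auto simp: X_def\<close>)
    define Tj where "Tj j = T \<inter> {x. \<kappa> x = j}" for j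
    have TjB: "Tj j \<in> sets \<mu>" for j unfolding Tj_def using TB \<kappa>(1) \<mu>(2) by auto
    have "T = (\<Union>j\<in>{..D}. Tj j)" unfolding Tj_def using \<kappa>(2) by auto
    then have "measure \<mu> T \<le> (\<Sum>j\<le>D. measure \<mu> (Tj j))"
      using finite_measure_subadditive_finite[of "{..D}" Tj] TjB by auto
    then have "real L * \<epsilon>' \<le> real L * (\<Sum>j\<le>D. measure \<mu> (Tj j))"
      using iab(2) unfolding T_def by (intro mult_left_mono) auto
    also have "\<dots> = (\<Sum>j\<le>D. \<Sum>s<L. measure \<mu> (Tj j))" by (simp add: sum_distrib_left)
    also have "\<dots> = (\<Sum>q\<in>X. measure \<mu> (Tj (fst q)))"
      unfolding X_def sum.cartesian_product by (simp add: case_prod_unfold)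
    finally have big: "real L * \<epsilon>' \<le> (\<Sum>q\<in>X. measure \<mu> (Tj (fst q)))" .
    \<comment> \<open>Averaging: if every pair failed, summation would bound
      \<open>real L * \<epsilon>'\<close> by half of itself plus 2, against the choice of
      \<open>L\<close>.\<close>
    have "\<exists>q\<in>X. \<delta> + measure \<mu> (z (2 * snd q) ` S q) + measure \<mu> (z (2 * snd q + 1) ` S q) \<le> measure \<mu> (Tj (fst q))"
    proof (rule ccontr)
      assume "\<not> ?thesis"
      then have "(\<Sum>q\<in>X. measure \<mu> (Tj (fst q))) \<le>
          (\<Sum>q\<in>X. \<delta> + measure \<mu> (z (2 * snd q + 0) ` S q) + measure \<mu> (z (2 * snd q + 1) ` S q))"
        by (intro sum_mono) (force simp: not_le)
      also have "\<dots> \<le> real (card X) * \<delta> + 1 + 1"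
        using total[of 0] total[of 1] by (simp add: sum.distrib)
      also have "real (card X) * \<delta> = real L * \<epsilon>' / 2" unfolding X_def \<delta>_def by (simp add: field_simps)
      finally have "real L * \<epsilon>' \<le> real L * \<epsilon>' / 2 + 2" using big by simp
      then show False using L \<epsilon>' by (simp add: field_simps)
    qed
    then obtain j s where js: "(j, s) \<in> X"
      "\<delta> + measure \<mu> (z (2 * s) ` S (j, s)) + measure \<mu> (z (2 * s + 1) ` S (j, s)) \<le> measure \<mu> (Tj j)" by force
    define M where "M = N (i, a, b) \<inter> {q. fst q \<in> {x. \<kappa> x = j}}"
    have DomM: "Domain M = Tj j" unfolding M_def Tj_def T_def by auto
    have Sjs: "S (j, s) = {y \<in> Domain M. \<forall>u\<le>2 * s. z (Suc u) y \<noteq> z u y}"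
      unfolding DomM S_def Tj_def by auto
    have "\<exists>q. matching_coloring E k q \<and> covered \<mu> k p + measure \<mu> (Domain M)
        \<le> covered \<mu> k q + measure \<mu> (z (2 * s) ` S (j, s)) + measure \<mu> (z (2 * s + 1) ` S (j, s))"
      unfolding Sjs z_def
    proof (rule augment[OF p E symE irr cyc ab _ _ _ _ _ _ fm \<mu>(2)])
      have "{q. fst q \<in> {x. \<kappa> x = j}} \<in> sets (borel :: ('a \<times> 'a) measure)"
        by (intro borel_Collect_continuous[OF _ \<kappa>(1)] continuous_intros)
      then show "M \<in> sets borel" unfolding M_def using NB by blast
      show "M \<subseteq> E" unfolding M_def using NE by blast
      show "x = x'" if "(y, x) \<in> M" "(y, x') \<in> M" for y x x'
      proof (rule \<kappa>'(3))
        have "(y, x) \<in> E" "(y, x') \<in> E" using that NE unfolding M_def by blast+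
        then show "(x, x') \<in> E O E" using symE by (meson relcomp.relcompI symD)
        show "\<kappa>' x = \<kappa>' x'" using that Nmem unfolding M_def by auto
      qed
      show "p c y \<noteq> x" if "(y, x) \<in> M" "c < k" for y x c using that Nmem unfolding M_def by auto
      show "p a x = x \<and> p b y = y" if "(y, x) \<in> M" for y x using that Nmem unfolding M_def by auto
      show "y = y'" if "y \<in> Domain M" "y' \<in> Domain M" "(y, y') \<in> (E\<^sup>=) ^^ (2 * s + 2)" for y y'
      proof (rule \<kappa>(3))
        have "2 * s + 2 \<le> 2 * L" using js(1) unfolding X_def by auto
        then show "(y, y') \<in> H" using that(3) relpow_reflcl_mono unfolding H_def by blast
        show "\<kappa> y = \<kappa> y'" using that(1,2) unfolding DomM Tj_def by simp
      qed
    qed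
    then obtain q where "matching_coloring E k q" "covered \<mu> k p + measure \<mu> (Domain M)
        \<le> covered \<mu> k q + measure \<mu> (z (2 * s) ` S (j, s)) + measure \<mu> (z (2 * s + 1) ` S (j, s))" by blast
    then show ?thesis using js(2) unfolding DomM by (intro exI[of _ q]) linarith
  qed
  then show thesis using that \<delta> by blast
qed

text \<open>Starting from the empty coloring, repeated gains of the same \<delta> would push
  \<open>covered\<close> beyond its bound \<open>k\<close>.\<close>

theorem almost_complete_coloring:
  assumes E: "bounded_borel_rel k E" and symE: "sym E" and irr: "\<And>x. (x, x) \<notin> E" and cyc: "\<not> has_odd_cycle E"
    and \<mu>: "prob_space \<mu>" "sets \<mu> = sets borel" and \<epsilon>: "\<epsilon> > 0"
  shows "\<exists>p. matching_coloring E k p \<and> measure \<mu> (incomplete E k p) < \<epsilon>"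
proof (rule ccontr)
  assume none: "\<not> ?thesis"
  interpret prob_space \<mu> by fact
  obtain \<delta> where \<delta>: "\<delta> > 0" "\<And>p. matching_coloring E k p \<Longrightarrow> \<epsilon> \<le> measure \<mu> (incomplete E k p) \<Longrightarrow>
      \<exists>q. matching_coloring E k q \<and> covered \<mu> k p + \<delta> \<le> covered \<mu> k q"
    using improvement[OF E symE irr cyc \<mu> \<epsilon>] by metis
  have "\<exists>p. matching_coloring E k p \<and> real n * \<delta> \<le> covered \<mu> k p" for n
  proof (induction n)
    case 0
    have "matching_coloring E k (\<lambda>_. id)" unfolding matching_coloring_def by (auto simp: id_def)
    moreover have "covered \<mu> k (\<lambda>_. id) = 0" unfolding covered_def by simp
    ultimately show ?case by (metis mult_zero_left of_nat_0 order_refl)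
  next
    case (Suc n)
    then obtain p where p: "matching_coloring E k p" "real n * \<delta> \<le> covered \<mu> k p" by blast
    then have "\<epsilon> \<le> measure \<mu> (incomplete E k p)" using none by (meson not_le)
    from \<delta>(2)[OF p(1) this] obtain q where "matching_coloring E k q" "covered \<mu> k p + \<delta> \<le> covered \<mu> k q" by blast
    then show ?case using p(2) by (intro exI[of _ q]) (simp add: algebra_simps)
  qed
  moreover obtain n where "real k / \<delta> < real n" using reals_Archimedean2 by blast
  ultimately obtain p where "matching_coloring E k p" "real n * \<delta> \<le> covered \<mu> k p" by blast
  moreover have "covered \<mu> k p \<le> of_nat (card {..<k}) * 1" unfolding covered_def
    by (rule sum_bounded_above) simp
  ultimately show False using \<open>real k / \<delta> < real n\<close> \<delta>(1) by (simp add: field_simps)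
qed

section \<open>Passage to edge colorings, and the two bounds on the index\<close>

lemma Corr_borel:
  assumes E: "bounded_borel_rel k E" and c: "edge_coloring E k c"
  shows "Corr E c \<in> sets borel"
proof -
  have EB: "E \<in> sets borel" and fin: "\<And>x. finite (E `` {x})" "\<And>x. card (E `` {x}) \<le> k"
    using E unfolding bounded_borel_rel_def by blast+
  define C where "C g = c -` {g} \<inter> E" for g
  have c': "c \<in> measurable (restrict_space borel E) (count_space {..<k})"
    using c unfolding edge_coloring_def borel_prod by blast
  have range: "c q < k" if "q \<in> E" for q
    using measurable_space[OF c', of q] that by (simp add: space_restrict_space)
  have CB: "C g \<in> sets borel" if "g < k" for g
  proof -
    have "c -` {g} \<inter> space (restrict_space borel E) \<in> sets (restrict_space borel E)"
      by (rule measurable_sets[OF c']) (use that in auto)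
    then have "c -` {g} \<inter> E \<in> sets (restrict_space borel E)" by (simp add: space_restrict_space)
    then show ?thesis unfolding C_def using EB by (simp add: sets_restrict_space_iff)
  qed
  \<comment> \<open>\<open>K\<close> pairs each vertex with two distinct neighbours reached in the
    same color. Its sections have at most \<open>k * k\<close> elements, so its projection, the
    complement of \<open>Corr E c\<close>, is Borel.\<close>
  define K where "K = (\<Union>g<k. {t :: 'a \<times> ('a \<times> 'a). (fst t, fst (snd t)) \<in> C g} \<inter> {t. (fst t, snd (snd t)) \<in> C g})
      - {t. snd t \<in> Id}"
  have "{t :: 'a \<times> ('a \<times> 'a). (fst t, fst (snd t)) \<in> C g} \<in> sets borel"
    "{t :: 'a \<times> ('a \<times> 'a). (fst t, snd (snd t)) \<in> C g} \<in> sets borel" if "g < k" for g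
    by (intro borel_Collect_continuous[OF _ CB[OF that]] continuous_intros)+
  moreover have "{t :: 'a \<times> ('a \<times> 'a). snd t \<in> Id} \<in> sets borel"
    by (intro borel_Collect_continuous[OF _ Id_borel] continuous_intros)
  ultimately have KB: "K \<in> sets borel" unfolding K_def by (intro sets.Diff sets.finite_UN sets.Int) auto
  have "finite (K `` {x}) \<and> card (K `` {x}) \<le> k * k" for x
  proof -
    have sub: "K `` {x} \<subseteq> (E `` {x}) \<times> (E `` {x})" unfolding K_def C_def by auto
    have "finite ((E `` {x}) \<times> (E `` {x}))" "card ((E `` {x}) \<times> (E `` {x})) \<le> k * k"
      using fin by (simp_all add: card_cartesian_product mult_le_mono)
    then show ?thesis using sub by (meson card_mono finite_subset order_trans)
  qed
  with KB have "Domain K \<in> sets borel" by (rule bounded_section_projection_borel)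
  then have "- Domain K \<in> sets borel" by (rule borel_comp)
  moreover have "Corr E c = - Domain K"
  proof (rule set_eqI)
    fix x
    have "x \<in> Domain K \<longleftrightarrow> (\<exists>y z. (x, y) \<in> E \<and> (x, z) \<in> E \<and> y \<noteq> z \<and> c (x, y) = c (x, z))"
      unfolding K_def C_def using range by (force simp: Domain_iff)
    then show "x \<in> Corr E c \<longleftrightarrow> x \<in> - Domain K" unfolding Corr_def by blast
  qed
  ultimately show ?thesis by simp
qed

lemma edge_coloring_of_matching_coloring:
  assumes p: "matching_coloring E k p" and E: "bounded_borel_rel k E" and symE: "sym E" and irr: "\<And>x. (x, x) \<notin> E"
  shows "\<exists>c. edge_coloring E k c \<and> - incomplete E k p \<subseteq> Corr E c"
proof -
  note pD = matching_coloringD[OF p]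
  have EB: "E \<in> sets borel" and fin: "\<And>x. finite (E `` {x})" "\<And>x. card (E `` {x}) \<le> k"
    using E unfolding bounded_borel_rel_def by blast+
  define P where "P = (\<lambda>q g. g < k \<and> p g (fst q) = snd q)"
  \<comment> \<open>Uncolored edges receive the default 0. This can create conflicts only at their
    ends, which are incomplete vertices.\<close>
  define c where "c q = (if \<exists>g. P q g then (SOME g. P q g) else 0)" for q
  have uniq: "g = h" if "P q g" "P q h" "q \<in> E" for g h q
    using pD(4)[of g h "fst q"] that irr unfolding P_def by (metis prod.collapse)
  have cP: "c q = g" if "P q g" "q \<in> E" for q g
  proof -
    have "P q (c q)" unfolding c_def using someI[of "P q" g] that by auto
    then show ?thesis using uniq that by blast
  qed
  have c0: "c q = 0" if "\<And>g. \<not> P q g" for q using that unfolding c_def by metis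
  \<comment> \<open>The default 0 is an admissible color as soon as there is an edge.\<close>
  have k0: "0 < k" if "q \<in> E" for q
  proof -
    have "snd q \<in> E `` {fst q}" using that by simp
    then have "0 < card (E `` {fst q})" using fin(1)[of "fst q"] by (metis card_gt_0_iff empty_iff)
    then show ?thesis using fin(2)[of "fst q"] by simp
  qed
  have range: "c q < k" if "q \<in> E" for q
    using cP[OF _ that] c0[of q] k0[OF that] unfolding P_def by (cases "\<exists>g. P q g") (auto simp: P_def)
  have CB: "{q. p g (fst q) = snd q} \<in> sets borel" for g by (rule color_class_borel[OF p])
  have "c \<in> measurable (restrict_space borel E) (count_space {..<k})"
  proof (subst measurable_count_space_eq2)
    have "c -` {g} \<inter> space (restrict_space borel E) \<in> sets (restrict_space borel E)" if g: "g < k" for g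
    proof -
      have eq: "c -` {g} \<inter> E = (E \<inter> {q. p g (fst q) = snd q})
          \<union> (if g = 0 then E - (\<Union>h<k. {q. p h (fst q) = snd q}) else {})"
      proof (rule set_eqI)
        fix q
        show "q \<in> c -` {g} \<inter> E \<longleftrightarrow> q \<in> (E \<inter> {q. p g (fst q) = snd q})
          \<union> (if g = 0 then E - (\<Union>h<k. {q. p h (fst q) = snd q}) else {})"
        proof (cases "q \<in> E \<and> (\<exists>h. P q h)")
          case True
          then obtain h where h: "P q h" "q \<in> E" by blast
          then have "c q = h" by (rule cP)
          moreover have "g = h" if "p g (fst q) = snd q" using uniq[OF _ h] that g unfolding P_def by blast
          ultimately show ?thesis using h unfolding P_def by auto
        next
          case False
          show ?thesis
          proof (cases "q \<in> E")
            case True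
            with False have no: "\<And>h. \<not> P q h" by blast
            then show ?thesis using True c0[OF no] g unfolding P_def by auto
          next
            case False
            then show ?thesis by auto
          qed
        qed
      qed
      have "(\<Union>h<k. {q. p h (fst q) = snd q}) \<in> sets borel" using CB by (intro sets.finite_UN) auto
      then have "c -` {g} \<inter> E \<in> sets borel" unfolding eq using EB CB[of g] by auto
      then show ?thesis using EB by (simp add: space_restrict_space sets_restrict_space_iff)
    qed
    moreover have "c \<in> space (restrict_space borel E) \<rightarrow> {..<k}" using range by (auto simp: space_restrict_space)
    ultimately show "c \<in> space (restrict_space borel E) \<rightarrow> {..<k} \<and>
        (\<forall>a\<in>{..<k}. c -` {a} \<inter> space (restrict_space borel E) \<in> sets (restrict_space borel E))" by blast
  qed simp
  moreover have "c (x, y) = c (y, x)" for x y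
  proof -
    \<comment> \<open>Equality as predicates is what makes \<open>SOME\<close> return the same color
      for both orientations.\<close>
    have "P (x, y) = P (y, x)" unfolding P_def fun_eq_iff using pD(2) by (metis fst_conv snd_conv)
    then show ?thesis unfolding c_def by (simp only:)
  qed
  ultimately have "edge_coloring E k c" unfolding edge_coloring_def borel_prod by blast
  moreover have "- incomplete E k p \<subseteq> Corr E c"
  proof
    fix x assume "x \<in> - incomplete E k p"
    then have ex: "\<exists>g<k. p g x = y" if "(x, y) \<in> E" for y using that unfolding incomplete_def by blast
    have "y = z" if yz: "(x, y) \<in> E" "(x, z) \<in> E" "c (x, y) = c (x, z)" for y z
    proof -
      obtain g h where gh: "g < k" "p g x = y" "h < k" "p h x = z" using ex[OF yz(1)] ex[OF yz(2)] by blast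
      then have "c (x, y) = g" "c (x, z) = h" using cP[of "(x, y)" g] cP[of "(x, z)" h] yz unfolding P_def by auto
      then show ?thesis using gh yz(3) by simp
    qed
    then show "x \<in> Corr E c" unfolding Corr_def by blast
  qed
  ultimately show ?thesis by blast
qed

text \<open>Under the point mass at \<open>x\<close>, taking \<epsilon> to be 1 already puts
  \<open>x\<close> into \<open>Corr E c\<close>. The coloring then embeds the neighbours of
  \<open>x\<close> into the \<open>k\<close> colors, which yields finiteness and the bound
  together.\<close>

lemma degree_le_of_approx_colorable:
  fixes E :: "('a::polish_space \<times> 'a) set"
  assumes "approx_colorable E k"
  shows "degree E x \<le> enat k"
proof -
  have "prob_space (return borel x)" by (rule prob_space_return) simp
  then have "\<exists>c. edge_coloring E k c \<and> Corr E c \<in> sets (return borel x) \<and> measure (return borel x) (Corr E c) > 1 - 1"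
    using assms unfolding approx_colorable_def by (metis sets_return zero_less_one)
  then obtain c where c: "edge_coloring E k c" "Corr E c \<in> sets borel" "measure (return borel x) (Corr E c) > 0"
    by auto
  have x: "x \<in> Corr E c"
    using c(3) measure_return[OF c(2), of x] by (simp split: split_indicator_asm)
  have meas: "c \<in> measurable (restrict_space borel E) (count_space {..<k})"
    using c(1) unfolding edge_coloring_def borel_prod by blast
  have range: "c (x, y) < k" if "y \<in> neighbours E x" for y
    using measurable_space[OF meas, of "(x, y)"] that by (simp add: space_restrict_space neighbours_def)
  have inj: "inj_on (\<lambda>y. c (x, y)) (neighbours E x)"
    using x unfolding Corr_def neighbours_def inj_on_def by blast
  have "(\<lambda>y. c (x, y)) ` neighbours E x \<subseteq> {..<k}" using range by auto
  then have "finite (neighbours E x)" "card (neighbours E x) \<le> k"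
    using inj_on_finite[OF inj, of "{..<k}"] card_inj_on_le[OF inj, of "{..<k}"] by simp_all
  then show ?thesis unfolding degree_def by simp
qed

theorem theorem1:
  fixes E :: "('a::polish_space \<times> 'a) set"
  assumes "borel_graph E"
    and "bounded_degree E"
    and "\<not> has_odd_cycle E"
  shows "enat (chi_app E) = max_degree E"
proof -
  obtain k where k: "max_degree E = enat k" using assms(2) unfolding bounded_degree_def by auto
  have deg: "degree E x \<le> enat k" for x unfolding k[symmetric] max_degree_def by (rule SUP_upper) simp
  have "finite (E `` {x}) \<and> card (E `` {x}) \<le> k" for x
    using deg[of x] unfolding degree_def neighbours_def by (cases "finite {y. (x, y) \<in> E}") (auto simp: Image_def)
  then have E: "bounded_borel_rel k E"
    using assms(1) unfolding bounded_borel_rel_def borel_graph_def borel_prod by blast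
  have symE: "sym E" and irr: "\<And>x. (x, x) \<notin> E" using assms(1) unfolding borel_graph_def sym_def by blast+
  have "approx_colorable E k" unfolding approx_colorable_def
  proof (intro allI impI)
    fix \<mu> :: "'a measure" and \<epsilon> :: real
    assume A: "sets \<mu> = sets borel \<and> prob_space \<mu> \<and> \<epsilon> > 0"
    then interpret prob_space \<mu> by blast
    obtain p where p: "matching_coloring E k p" "measure \<mu> (incomplete E k p) < \<epsilon>"
      using almost_complete_coloring[OF E symE irr assms(3)] A by blast
    obtain c where c: "edge_coloring E k c" "- incomplete E k p \<subseteq> Corr E c"
      using edge_coloring_of_matching_coloring[OF p(1) E symE irr] by blast
    have Corr: "Corr E c \<in> sets \<mu>" using Corr_borel[OF E c(1)] A by simp
    have inc: "incomplete E k p \<in> sets \<mu>" using incomplete_borel[OF p(1) E] A by simp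
    have sp: "space \<mu> = UNIV" using A sets_eq_imp_space_eq[of \<mu> borel] by simp
    have "1 - measure \<mu> (incomplete E k p) = measure \<mu> (- incomplete E k p)"
      using prob_compl[OF inc] sp by (simp add: Compl_eq_Diff_UNIV)
    also have "\<dots> \<le> measure \<mu> (Corr E c)" using c(2) Corr by (rule finite_measure_mono)
    finally show "\<exists>c. edge_coloring E k c \<and> Corr E c \<in> sets \<mu> \<and> 1 - \<epsilon> < measure \<mu> (Corr E c)"
      using c(1) Corr p(2) by (intro exI[of _ c]) simp
  qed
  moreover have "k \<le> j" if "approx_colorable E j" for j
  proof -
    have "max_degree E \<le> enat j" unfolding max_degree_def
      using degree_le_of_approx_colorable[OF that] by (rule SUP_least)
    then show ?thesis using k by simp
  qed
  ultimately have "chi_app E = k" unfolding chi_app_def by (rule Least_equality)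
  then show ?thesis using k by simp
qed

end
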